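(* Let $q$ be real with $0<|q|<1$, let $c\in\mathbb{R}$, $b<0$ and $\lambda\in\mathbb{R}$, and suppose that $1+\lambda q^k/b>0$ for all $k\ge 1$. Let $\{P_k(x)\}_{k\ge 0}$ be the polynomials defined by $P_0(x)=1$, $P_1(x)=x-c$ and $$xP_k(x)=P_{k+1}(x)+cq^kP_k(x)+\tfrac14\left(1+\lambda q^k/b\right)P_{k-1}(x),\qquad k>0.$$ Then there is a positive measure $\mu$ on $\mathbb{R}$ such that for all $m,n\ge 0$ $$\int P_n(x)P_m(x)\,d\mu(x)=\frac{1}{4^n}(-\lambda q/b;q)_n\,\delta_{mn},$$ where $\mu$ has an absolutely continuous component whose density is given, for $x=\cos\vartheta\in(-1,1)$ with $\vartheta\in(0,\pi)$, by $$\mu'(x)=\frac{2}{\pi}\,\frac{(-\lambda q/b;q)_\infty}{|R|^2\sqrt{1-x^2}},\qquad R=\frac{-1}{i\sin\vartheta}\sum_{m=0}^{\infty}\frac{(-\lambda q e^{i\vartheta}/2bc;q)_m}{(q;q)_m\,(qe^{2i\vartheta};q)_m}(-2c)^m e^{im\vartheta}q^{\binom m2}.$$ Further, if $\mu$ has a discrete part, it lies outside $(-1,1)$.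
   Context: $q$-rising factorials: $(a;q)_0=1$, $(a;q)_n=(1-a)(1-aq)\cdots(1-aq^{n-1})$ for $n\ge1$, and $(a;q)_\infty=\prod_{k\ge0}(1-aq^k)$ for $|q|<1$. The expression $-\lambda q e^{i\vartheta}/2bc$ means $-\lambda q e^{i\vartheta}/(2bc)$. When $c=0$, the product $(-\lambda q e^{i\vartheta}/2bc;q)_m(-2c)^m$ is understood as its continuous extension $\prod_{j=0}^{m-1}\left(-2c-\lambda q^{j+1}e^{i\vartheta}/b\right)$. $\delta_{mn}$ is the Kronecker delta. *)

theory Defs
  imports "HOL-Analysis.Analysis" "HOL-Computational_Algebra.Polynomial"
begin

definition q_rising :: "'a::comm_ring_1 \<Rightarrow> 'a \<Rightarrow> nat \<Rightarrow> 'a" where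
  "q_rising a q n = (\<Prod>k<n. 1 - a * q ^ k)"

definition q_rising_inf :: "'a::real_normed_field \<Rightarrow> 'a \<Rightarrow> 'a" where
  "q_rising_inf a q = (\<Prod>k. 1 - a * q ^ k)"

text \<open>The product \<open>(-\<lambda> q e\<^sup>i\<^sup>\<theta> / (2bc); q)\<^sub>m (-2c)\<^sup>m\<close>. Its argument is undefined at \<open>c = 0\<close>, where the
  continuous extension in \<open>c\<close> is taken.\<close>

definition R_numerator :: "real \<Rightarrow> real \<Rightarrow> real \<Rightarrow> real \<Rightarrow> real \<Rightarrow> nat \<Rightarrow> complex" where
  "R_numerator q b c l \<theta> m =
     (if c = 0
      then (\<Prod>j<m. - 2 * of_real c - of_real l * of_real q ^ (j + 1) * exp (\<i> * of_real \<theta>) / of_real b)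
      else q_rising (- of_real l * of_real q * exp (\<i> * of_real \<theta>) / (2 * of_real b * of_real c))
             (of_real q) m * (- 2 * of_real c) ^ m)"

definition R_fun :: "real \<Rightarrow> real \<Rightarrow> real \<Rightarrow> real \<Rightarrow> real \<Rightarrow> complex" where
  "R_fun q b c l \<theta> =
     - 1 / (\<i> * of_real (sin \<theta>)) *
     (\<Sum>m. R_numerator q b c l \<theta> m
            / (q_rising (of_real q) (of_real q) m
               * q_rising (of_real q * exp (2 * \<i> * of_real \<theta>)) (of_real q) m)
            * exp (\<i> * of_nat m * of_real \<theta>) * of_real q ^ (m choose 2))"

definition mutually_singular :: "'a measure \<Rightarrow> 'a measure \<Rightarrow> bool" where
  "mutually_singular M N \<longleftrightarrow>
     sets M = sets N \<and> (\<exists>A\<in>sets M. emeasure M A = 0 \<and> emeasure N (space N - A) = 0)"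

text \<open>\<open>f\<close> is a density of the absolutely continuous component of \<open>M\<close> in its Lebesgue
  decomposition with respect to Lebesgue measure; it is determined by \<open>M\<close> only almost everywhere.\<close>

definition ac_component_density :: "real measure \<Rightarrow> (real \<Rightarrow> ennreal) \<Rightarrow> bool" where
  "ac_component_density M f \<longleftrightarrow>
     f \<in> borel_measurable lborel \<and>
     (\<exists>S. mutually_singular S lborel \<and>
          (\<forall>A\<in>sets borel. emeasure M A = emeasure (density lborel f) A + emeasure S A))"

text \<open>The points carrying the discrete (pure point) part of \<open>M\<close>.\<close>

definition point_masses :: "'a measure \<Rightarrow> 'a set" where
  "point_masses M = {x \<in> space M. emeasure M {x} > 0}"

end

theory Submission
  imports Defs "HOL-Probability.Probability" "HOL-Computational_Algebra.Fundamental_Theorem_Algebra"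
begin

text \<open>The recurrence coefficients converge geometrically to those of the Chebyshev polynomials of the
  second kind, and the proof compares the two recurrences.

  Favard's theorem gives an orthogonality measure \<open>\<mu>\<close> with bounded support: it is a weak limit of
  Gauss quadrature measures (\<open>favard_bounded\<close>).

  To find \<open>\<mu>\<close> inside \<open>(-1, 1)\<close>, put \<open>p n = 2 ^ n P n\<close> and consider the Turan determinants
  \<open>D n = (p (n + 1))\<^sup>2 - p (n + 2) p n\<close>. Two limits of them are computed.
  Far out, the Jacobi matrix looks like the free one, and this alone implies that \<open>D n\<close> times \<open>\<mu>\<close>
  converges weakly to \<open>(2 / \<pi>) T sqrt (1 - x\<^sup>2) dx\<close> with \<open>T = (-\<lambda> q / b; q)\<^sub>\<infinity>\<close> (\<open>turan_det_limit\<close>);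
  here \<open>T\<close> is the limit of the squared norms of the \<open>p n\<close>.
  On the other hand, the series in the definition of \<open>R\<close>, with \<open>(c, \<lambda>)\<close> replaced by \<open>(c q ^ k, \<lambda> q ^ k)\<close>,
  solves an adjoint recurrence in \<open>k\<close> and tends to 1 (\<open>jost_recurrence\<close>, \<open>norm_jost_minus_1\<close>).
  Its Wronskian with the polynomials is constant and equal to the series \<open>F\<close> itself (\<open>wronskian\<close>).
  Taking squared moduli in the limit shows that \<open>D n\<close> tends to \<open>|F|\<^sup>2 = |R|\<^sup>2 (sin \<theta>)\<^sup>2\<close> pointwise and
  boundedly on compact subsets of \<open>(-1, 1)\<close>, and that \<open>F\<close> has no zero there (\<open>turan_tendsto\<close>,
  \<open>turan_locally_bounded\<close>, \<open>jost_nonzero\<close>).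

  Hence \<open>|F|\<^sup>2 \<mu> = (2 / \<pi>) T sqrt (1 - x\<^sup>2) dx\<close> on \<open>(-1, 1)\<close> (\<open>density_from_weak_limit\<close>). So \<open>\<mu>\<close> is
  absolutely continuous there with the stated density, and it has no point mass there. Outside
  \<open>(-1, 1)\<close> the Lebesgue decomposition completes the absolutely continuous component.\<close>

section \<open>Favard's theorem for bounded recurrence coefficients\<close>

locale monic_recurrence =
  fixes P :: "nat \<Rightarrow> real poly" and \<beta> \<gamma> :: "nat \<Rightarrow> real"
  assumes P_0: "P 0 = 1"
    and P_1: "P (Suc 0) = [:- \<beta> 0, 1:]"
    and P_Suc: "\<And>k. P (Suc (Suc k)) = [:- \<beta> (Suc k), 1:] * P (Suc k) - smult (\<gamma> (Suc k)) (P k)"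
    and \<gamma>_pos: "\<And>k. \<gamma> (Suc k) > 0"
begin

text \<open>The squared norms of the \<open>P n\<close> under the orthogonality measure that is to be constructed.\<close>

definition sqnorm :: "nat \<Rightarrow> real" where "sqnorm n = (\<Prod>i<n. \<gamma> (Suc i))"

definition christoffel_kernel :: "nat \<Rightarrow> real \<Rightarrow> real \<Rightarrow> real" where
  "christoffel_kernel n x y = (\<Sum>k\<le>n. poly (P k) x * poly (P k) y / sqnorm k)"

definition zeros :: "nat \<Rightarrow> real set" where
  "zeros n = {x. poly (P n) x = 0}"

lemma sqnorm_0 [simp]: "sqnorm 0 = 1" and sqnorm_Suc: "sqnorm (Suc n) = \<gamma> (Suc n) * sqnorm n" and sqnorm_pos: "sqnorm n > 0"
  by (auto simp: sqnorm_def \<gamma>_pos intro!: prod_pos)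

lemma degree_lead_P: "degree (P n) = n \<and> lead_coeff (P n) = 1"
proof (induction n rule: less_induct)
  case (less n)
  consider "n = 0" | "n = 1" | k where "n = Suc (Suc k)"
    by (metis One_nat_def not0_implies_Suc)
  then show ?case
  proof cases
    case 3
    have IH: "degree (P k) = k" "degree (P (Suc k)) = Suc k" "lead_coeff (P (Suc k)) = 1"
      using less[of k] less[of "Suc k"] 3 by auto
    have ne: "P (Suc k) \<noteq> 0" using IH by auto
    have d1: "degree ([:- \<beta> (Suc k), 1:] * P (Suc k)) = Suc (Suc k)"
      using ne IH by (subst degree_mult_eq) auto
    have d2: "degree (smult (\<gamma> (Suc k)) (P k)) < Suc (Suc k)"
      using IH by (simp add: le_imp_less_Suc)
    have "degree (P n) = Suc (Suc k)"
      unfolding 3 P_Suc diff_conv_add_uminus using d1 d2 by (subst degree_add_eq_left) auto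
    moreover have "coeff (P n) (Suc (Suc k)) = coeff ([:- \<beta> (Suc k), 1:] * P (Suc k)) (Suc (Suc k))"
      unfolding 3 P_Suc using IH(1) by (simp add: coeff_eq_0 del: mult_pCons_left)
    moreover have "\<dots> = 1"
      using IH(2,3) by (simp add: coeff_eq_0)
    ultimately show ?thesis using 3 by simp
  qed (auto simp: P_0 P_1)
qed

lemma degree_P [simp]: "degree (P n) = n" and P_nonzero [simp]: "P n \<noteq> 0"
  using degree_lead_P[of n] by auto

lemma P_independent:
  assumes "(\<Sum>k\<le>n. smult (a k) (P k)) = 0" "k \<le> n"
  shows "a k = 0"
  using assms
proof (induction n arbitrary: k)
  case (Suc n)
  have deg: "degree (\<Sum>k\<le>n. smult (a k) (P k)) \<le> n"
    by (rule degree_sum_le) (auto intro: order_trans[OF degree_smult_le])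
  have "coeff (\<Sum>k\<le>Suc n. smult (a k) (P k)) (Suc n) = a (Suc n)"
    using deg degree_lead_P[of "Suc n"] by (simp add: coeff_eq_0)
  with Suc.prems have z: "a (Suc n) = 0" by simp
  with Suc show ?case by (cases "k = Suc n") auto
qed (auto simp: P_0)

text \<open>Both sides satisfy the same first-order recursion in \<open>n\<close>. The identity concerns arbitrary solutions
  of the recurrence, so that it applies to real points (where it gives the kernel at two zeros) and to
  a complex point with its conjugate (where it forces the zeros to be real).\<close>

lemma christoffel_darboux:
  fixes u v :: "nat \<Rightarrow> 'a::real_field"
  assumes u: "u (Suc 0) = (x - of_real (\<beta> 0)) * u 0"
      "\<And>k. u (Suc (Suc k)) = (x - of_real (\<beta> (Suc k))) * u (Suc k) - of_real (\<gamma> (Suc k)) * u k"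
    and v: "v (Suc 0) = (y - of_real (\<beta> 0)) * v 0"
      "\<And>k. v (Suc (Suc k)) = (y - of_real (\<beta> (Suc k))) * v (Suc k) - of_real (\<gamma> (Suc k)) * v k"
  shows "(x - y) * (\<Sum>k\<le>n. u k * v k / of_real (sqnorm k))
           = (u (Suc n) * v n - u n * v (Suc n)) / of_real (sqnorm n)"
proof (induction n)
  case 0
  then show ?case by (simp add: u v algebra_simps)
next
  case (Suc n)
  have step: "(U * w - s * V) / H + (x - y) * (U * V / (G * H))
      = (((x - b) * U - G * s) * V - U * ((y - b) * V - G * w)) / (G * H)"
    if "H \<noteq> 0" "G \<noteq> 0" for U V w s b G H :: 'a
  proof -
    have "(U * w - s * V) / H = G * (U * w - s * V) / (G * H)" using that by simp
    then show ?thesis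
      by (simp only: times_divide_eq_right add_divide_distrib[symmetric]) (simp add: algebra_simps)
  qed
  have "(x - y) * (\<Sum>k\<le>Suc n. u k * v k / of_real (sqnorm k)) =
      (u (Suc n) * v n - u n * v (Suc n)) / of_real (sqnorm n)
      + (x - y) * (u (Suc n) * v (Suc n) / (of_real (\<gamma> (Suc n)) * of_real (sqnorm n)))"
    by (simp only: sum.atMost_Suc distrib_left Suc.IH sqnorm_Suc of_real_mult)
  also have "\<dots> = (u (Suc (Suc n)) * v (Suc n) - u (Suc n) * v (Suc (Suc n))) / (of_real (\<gamma> (Suc n)) * of_real (sqnorm n))"
    unfolding u(2) v(2) using sqnorm_pos[of n] \<gamma>_pos[of n] by (intro step) auto
  finally show ?case by (simp only: sqnorm_Suc of_real_mult)
qed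

lemma poly_P_recurrence:
  "poly (P (Suc 0)) x = (x - \<beta> 0) * poly (P 0) x"
  "poly (P (Suc (Suc k))) x = (x - \<beta> (Suc k)) * poly (P (Suc k)) x - \<gamma> (Suc k) * poly (P k) x"
  by (simp_all add: P_0 P_1 P_Suc algebra_simps)

lemma christoffel_kernel_zeros:
  assumes "x \<in> zeros (Suc n)" "y \<in> zeros (Suc n)" "x \<noteq> y"
  shows "christoffel_kernel n x y = 0"
  using christoffel_darboux[of "\<lambda>k. poly (P k) x" x "\<lambda>k. poly (P k) y" y n] assms
  by (simp add: poly_P_recurrence zeros_def christoffel_kernel_def)

lemma christoffel_kernel_pos: "christoffel_kernel n x x > 0"
proof -
  have "0 < poly (P 0) x * poly (P 0) x / sqnorm 0" by (simp add: P_0)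
  also have "\<dots> \<le> christoffel_kernel n x x"
    unfolding christoffel_kernel_def using sqnorm_pos
    by (intro member_le_sum) (auto intro!: divide_nonneg_pos)
  finally show ?thesis .
qed

text \<open>Up to a factor this is the value of the Christoffel--Darboux kernel on the diagonal, obtained by
  letting the two points of the identity above coincide. At a double zero it would vanish.\<close>

lemma confluent_wronskian_pos:
  "poly (pderiv (P (Suc n))) x * poly (P n) x - poly (pderiv (P n)) x * poly (P (Suc n)) x > 0"
proof (induction n)
  case 0
  then show ?case by (simp add: P_0 P_1 pderiv_pCons)
next
  case (Suc n)
  let ?W = "\<lambda>n. poly (pderiv (P (Suc n))) x * poly (P n) x - poly (pderiv (P n)) x * poly (P (Suc n)) x"
  have "?W (Suc n) = (poly (P (Suc n)) x)\<^sup>2 + \<gamma> (Suc n) * ?W n"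
    by (simp add: P_Suc pderiv_diff pderiv_smult pderiv_mult pderiv_add pderiv_pCons power2_eq_square algebra_simps)
  also have "\<dots> > 0"
    using Suc \<gamma>_pos[of n] by (intro add_nonneg_pos mult_pos_pos) auto
  finally show ?case .
qed

text \<open>At a zero \<open>w\<close> the right-hand side of the Christoffel--Darboux identity for \<open>w\<close> and its conjugate
  vanishes, while the sum on the left is at least its first term, which is 1.\<close>

lemma complex_zero_is_real:
  fixes w :: complex
  assumes "poly (map_poly of_real (P (Suc n))) w = 0"
  shows "w \<in> \<real>"
proof -
  define u where "u k w = poly (map_poly of_real (P k)) w" for k and w :: complex
  have hom: "map_poly complex_of_real (p - q) = map_poly of_real p - map_poly of_real q"
    "map_poly complex_of_real (p + q) = map_poly of_real p + map_poly of_real q" for p q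
    by (rule poly_eqI, simp add: coeff_map_poly)+
  have u0: "u 0 w = 1" "u (Suc 0) w = (w - of_real (\<beta> 0)) * u 0 w"
    "u (Suc (Suc k)) w = (w - of_real (\<beta> (Suc k))) * u (Suc k) w - of_real (\<gamma> (Suc k)) * u k w" for w k
    by (simp_all add: u_def P_0 P_1 P_Suc map_poly_pCons hom map_poly_smult algebra_simps)
  have cnj: "u k (cnj w) = cnj (u k w)" for k
  proof -
    have "map_poly cnj (map_poly complex_of_real (P k)) = map_poly complex_of_real (P k)"
      by (rule poly_eqI) (simp add: coeff_map_poly)
    then show ?thesis unfolding u_def by (metis complex_cnj_cnj poly_map_poly_cnj)
  qed
  have "(w - cnj w) * (\<Sum>k\<le>n. u k w * u k (cnj w) / of_real (sqnorm k)) =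
      (u (Suc n) w * u n (cnj w) - u n w * u (Suc n) (cnj w)) / of_real (sqnorm n)"
    by (rule christoffel_darboux) (simp_all only: u0)
  also have "\<dots> = 0" using assms unfolding cnj by (simp add: u_def)
  finally have "(w - cnj w) * (\<Sum>k\<le>n. u k w * u k (cnj w) / of_real (sqnorm k)) = 0" .
  moreover have "(\<Sum>k\<le>n. u k w * u k (cnj w) / of_real (sqnorm k)) = of_real (\<Sum>k\<le>n. (cmod (u k w))\<^sup>2 / sqnorm k)"
    unfolding cnj complex_norm_square[symmetric] by simp
  moreover have "(\<Sum>k\<le>n. (cmod (u k w))\<^sup>2 / sqnorm k) > 0"
  proof -
    have "0 < (cmod (u 0 w))\<^sup>2 / sqnorm 0" by (simp add: u0)
    also have "\<dots> \<le> (\<Sum>k\<le>n. (cmod (u k w))\<^sup>2 / sqnorm k)"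
      using sqnorm_pos by (intro member_le_sum) (auto intro!: divide_nonneg_pos)
    finally show ?thesis .
  qed
  ultimately have "w = cnj w" by (auto simp: of_real_sum[symmetric] simp del: of_real_sum)
  then show ?thesis using Reals_cnj_iff by metis
qed

lemma finite_zeros: "finite (zeros n)"
  unfolding zeros_def by (rule poly_roots_finite) simp

lemma card_zeros: "card (zeros (Suc n)) = Suc n"
proof -
  let ?Q = "map_poly complex_of_real (P (Suc n))"
  have ev: "poly (map_poly complex_of_real p) (of_real x) = of_real (poly p x)" for p x
    by (induction p) (auto simp: map_poly_pCons)
  have pd: "pderiv ?Q = map_poly complex_of_real (pderiv (P (Suc n)))"
    by (rule poly_eqI) (simp add: coeff_map_poly coeff_pderiv)
  have roots: "{z. poly ?Q z = 0} = complex_of_real ` zeros (Suc n)"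
  proof (intro set_eqI iffI)
    fix w assume w: "w \<in> {z. poly ?Q z = 0}"
    then obtain x where "w = of_real x" using complex_zero_is_real[of n w] by (auto elim: Reals_cases)
    with w show "w \<in> complex_of_real ` zeros (Suc n)" by (auto simp: zeros_def ev)
  qed (auto simp: zeros_def ev)
  have rs: "rsquarefree ?Q"
    unfolding rsquarefree_roots
  proof (intro allI notI)
    fix a assume a: "poly ?Q a = 0 \<and> poly (pderiv ?Q) a = 0"
    then obtain x where x: "a = of_real x" using complex_zero_is_real[of n a] by (auto elim: Reals_cases)
    with a show False
      using confluent_wronskian_pos[of n x] by (simp add: pd ev)
  qed
  have dQ: "degree ?Q = Suc n" by (simp add: degree_map_poly)
  then have lc: "lead_coeff ?Q \<noteq> 0" using degree_lead_P[of "Suc n"] by (simp del: leading_coeff_0_iff add: coeff_map_poly)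
  have "card {z. poly ?Q z = 0} = degree (smult (lead_coeff ?Q) (\<Prod>z|poly ?Q z = 0. [:-z, 1:]))"
    unfolding degree_smult_eq using lc by (simp add: degree_prod_sum_eq)
  also have "\<dots> = Suc n"
    by (subst complex_poly_decompose_rsquarefree[OF rs]) (rule dQ)
  finally have "card {z. poly ?Q z = 0} = Suc n" .
  then show ?thesis unfolding roots by (subst (asm) card_image) (auto simp: inj_on_def)
qed

text \<open>A zero \<open>x\<close> of \<open>P (Suc n)\<close> is an eigenvalue of the truncated Jacobi matrix with eigenvector
  \<open>(P 0 x, \<dots>, P n x)\<close>; the recurrence at an entry of greatest modulus bounds it.\<close>

lemma zeros_bounded:
  assumes B: "\<And>k. \<bar>\<beta> k\<bar> \<le> B1" "\<And>k. \<gamma> (Suc k) \<le> B2" and x: "x \<in> zeros (Suc n)"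
  shows "\<bar>x\<bar> \<le> 1 + B1 + B2"
proof -
  let ?v = "\<lambda>k. poly (P k) x"
  define m where "m = Max ((\<lambda>j. \<bar>?v j\<bar>) ` {..n})"
  have "m \<in> (\<lambda>j. \<bar>?v j\<bar>) ` {..n}" unfolding m_def by (rule Max_in) auto
  then obtain k where "k \<le> n" and "m = \<bar>?v k\<bar>" by auto
  moreover have "\<bar>?v j\<bar> \<le> m" if "j \<le> n" for j
    unfolding m_def using that by (intro Max_ge) auto
  ultimately have k: "k \<le> n" "\<And>j. j \<le> n \<Longrightarrow> \<bar>?v j\<bar> \<le> \<bar>?v k\<bar>" by auto
  have pos: "\<bar>?v k\<bar> > 0" using k(2)[of 0] by (simp add: P_0)
  have nxt: "\<bar>?v (Suc k)\<bar> \<le> \<bar>?v k\<bar>"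
    using k x by (cases "k = n") (auto simp: zeros_def)
  have B0: "B1 \<ge> 0" "B2 \<ge> 0" using B(1)[of 0] B(2)[of 0] \<gamma>_pos[of 0] by linarith+
  have bk: "\<bar>\<beta> k\<bar> * \<bar>?v k\<bar> \<le> B1 * \<bar>?v k\<bar>" using B by (intro mult_right_mono) auto
  define g where "g = (case k of 0 \<Rightarrow> 0 | Suc j \<Rightarrow> \<gamma> (Suc j) * ?v j)"
  have g: "\<bar>g\<bar> \<le> B2 * \<bar>?v k\<bar>"
  proof (cases k)
    case (Suc j)
    have "\<bar>\<gamma> (Suc j)\<bar> * \<bar>?v j\<bar> \<le> B2 * \<bar>?v k\<bar>"
      using B(2)[of j] k Suc \<gamma>_pos[of j] by (intro mult_mono) auto
    then show ?thesis by (simp add: g_def Suc abs_mult)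
  qed (use B0 in \<open>simp add: g_def\<close>)
  have "x * ?v k = ?v (Suc k) + \<beta> k * ?v k + g"
    by (cases k) (simp_all add: poly_P_recurrence g_def algebra_simps)
  then have "\<bar>x\<bar> * \<bar>?v k\<bar> = \<bar>?v (Suc k) + \<beta> k * ?v k + g\<bar>" by (metis abs_mult)
  also have "\<dots> \<le> \<bar>?v (Suc k)\<bar> + \<bar>\<beta> k * ?v k\<bar> + \<bar>g\<bar>" by linarith
  also have "\<dots> \<le> (1 + B1 + B2) * \<bar>?v k\<bar>"
    using nxt bk g by (simp add: abs_mult algebra_simps)
  finally have "\<bar>x\<bar> * \<bar>?v k\<bar> \<le> (1 + B1 + B2) * \<bar>?v k\<bar>" .
  then show ?thesis using pos by simp
qed

text \<open>By \<open>christoffel_kernel_zeros\<close> the functions \<open>christoffel_kernel n s / christoffel_kernel n s s\<close> are the Lagrange basis at the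
  zeros. Interpolating \<open>P l\<close> with it exhibits \<open>P l\<close> as a combination of the \<open>P k\<close> whose coefficients are
  the quadrature sums divided by \<open>sqnorm k\<close>; linear independence then determines these sums.\<close>

lemma gauss_quadrature:
  assumes "k \<le> n" "l \<le> n"
  shows "(\<Sum>s\<in>zeros (Suc n). poly (P k) s * poly (P l) s / christoffel_kernel n s s) = (if k = l then sqnorm k else 0)"
proof -
  let ?Z = "zeros (Suc n)"
  define A where "A k = (\<Sum>s\<in>?Z. poly (P k) s * poly (P l) s / christoffel_kernel n s s)" for k
  \<comment> \<open>The difference of the interpolant and \<open>P l\<close>: its degree is at most \<open>n\<close>, and it has \<open>Suc n\<close> zeros.\<close>
  define f where "f = (\<Sum>k\<le>n. smult (A k / sqnorm k - (if k = l then 1 else 0)) (P k))"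
  have christoffel_kernel_eq: "christoffel_kernel n s t / christoffel_kernel n s s = (if s = t then 1 else 0)" if "s \<in> ?Z" "t \<in> ?Z" for s t
    using christoffel_kernel_zeros[OF that] christoffel_kernel_pos[of n s] by auto
  have "poly f t = 0" if t: "t \<in> ?Z" for t
  proof -
    have "(\<Sum>k\<le>n. A k / sqnorm k * poly (P k) t) = (\<Sum>k\<le>n. \<Sum>s\<in>?Z. poly (P l) s * (poly (P k) s * poly (P k) t / sqnorm k / christoffel_kernel n s s))"
      unfolding A_def sum_divide_distrib sum_distrib_right by (intro sum.cong refl) (simp add: field_simps)
    also have "\<dots> = (\<Sum>s\<in>?Z. poly (P l) s * (christoffel_kernel n s t / christoffel_kernel n s s))"
      unfolding christoffel_kernel_def[of n _ t] sum_divide_distrib sum_distrib_left by (subst sum.swap) simp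
    also have "\<dots> = (\<Sum>s\<in>?Z. if s = t then poly (P l) s else 0)"
      using t by (intro sum.cong refl) (auto simp: christoffel_kernel_eq)
    also have "\<dots> = poly (P l) t" using t finite_zeros by simp
    finally have e: "(\<Sum>k\<le>n. A k / sqnorm k * poly (P k) t) = poly (P l) t" .
    have "poly f t = (\<Sum>k\<le>n. A k / sqnorm k * poly (P k) t) - (\<Sum>k\<le>n. if k = l then poly (P k) t else 0)"
      unfolding f_def poly_sum sum_subtractf[symmetric]
      by (intro sum.cong refl) (auto simp: algebra_simps)
    then show ?thesis using e assms by simp
  qed
  then have sub: "?Z \<subseteq> {x. poly f x = 0}" by auto
  have deg: "degree f \<le> n"
    unfolding f_def by (rule degree_sum_le) (auto intro: order_trans[OF degree_smult_le])
  have "f = 0"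
  proof (rule ccontr)
    assume f: "f \<noteq> 0"
    have "card ?Z \<le> card {x. poly f x = 0}" using sub poly_roots_finite[OF f] by (intro card_mono)
    also have "\<dots> \<le> degree f" by (rule card_poly_roots_bound[OF f])
    finally show False using deg by (simp add: card_zeros)
  qed
  then have "A k / sqnorm k - (if k = l then 1 else 0) = 0"
    using P_independent[of "\<lambda>k. A k / sqnorm k - (if k = l then 1 else 0)" n k] assms by (simp add: f_def)
  then show ?thesis using sqnorm_pos[of k] by (auto simp: A_def split: if_splits)
qed


definition gauss_measure :: "nat \<Rightarrow> real measure" where
  "gauss_measure n = distr (point_measure (zeros (Suc n)) (\<lambda>s. ennreal (1 / christoffel_kernel n s s))) borel (\<lambda>x. x)"

lemma integral_gauss_measure:
  fixes f :: "real \<Rightarrow> real"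
  assumes "f \<in> borel_measurable borel"
  shows "integral\<^sup>L (gauss_measure n) f = (\<Sum>s\<in>zeros (Suc n). f s / christoffel_kernel n s s)"
proof -
  have "integral\<^sup>L (gauss_measure n) f
      = integral\<^sup>L (point_measure (zeros (Suc n)) (\<lambda>s. ennreal (1 / christoffel_kernel n s s))) f"
    unfolding gauss_measure_def using assms by (intro integral_distr) auto
  also have "\<dots> = (\<Sum>s\<in>zeros (Suc n). (1 / christoffel_kernel n s s) *\<^sub>R f s)"
    using finite_zeros christoffel_kernel_pos by (intro lebesgue_integral_point_measure_finite) (auto intro: less_imp_le)
  finally show ?thesis by simp
qed

lemma real_distribution_gauss_measure: "real_distribution (gauss_measure n)"
proof -
  have "(\<Sum>s\<in>zeros (Suc n). 1 / christoffel_kernel n s s) = 1"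
    using gauss_quadrature[of 0 n 0] by (simp add: P_0)
  moreover have "0 \<le> 1 / christoffel_kernel n s s" for s using christoffel_kernel_pos[of n s] by simp
  ultimately have "(\<Sum>s\<in>zeros (Suc n). ennreal (1 / christoffel_kernel n s s)) = 1"
    by (subst sum_ennreal) auto
  then have "prob_space (point_measure (zeros (Suc n)) (\<lambda>s. ennreal (1 / christoffel_kernel n s s)))"
    using finite_zeros by (intro prob_space_point_measure) auto
  then show ?thesis
    unfolding gauss_measure_def by (intro prob_space.real_distribution_distr) auto
qed

lemma measure_gauss_eq_1:
  assumes "zeros (Suc n) \<subseteq> A" "A \<in> sets borel"
  shows "measure (gauss_measure n) A = 1"
proof -
  interpret real_distribution "gauss_measure n" by (rule real_distribution_gauss_measure)
  have "AE x in gauss_measure n. x \<in> A"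
    unfolding gauss_measure_def using assms by (subst AE_distr_iff) (auto simp: AE_point_measure)
  then show ?thesis using assms by (subst prob_eq_1) auto
qed

text \<open>All Gauss measures live on one bounded interval, so Helly's theorem provides a weak limit, which
  lives there too. Every orthogonality relation holds for almost all of the measures, and polynomials
  may be tested against weak convergence because they are bounded on that interval.\<close>

theorem favard_bounded:
  assumes bdd: "\<And>k. \<bar>\<beta> k\<bar> \<le> B1" "\<And>k. \<gamma> (Suc k) \<le> B2"
  shows "\<exists>M B. real_distribution M \<and> (AE x in M. \<bar>x\<bar> \<le> B) \<and>
    (\<forall>k l. (LINT x|M. poly (P k) x * poly (P l) x) = (if k = l then sqnorm k else 0))"
proof -
  define B where "B = 1 + B1 + B2"
  have B: "B > 0" using bdd(1)[of 0] bdd(2)[of 0] \<gamma>_pos[of 0] unfolding B_def by linarith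
  have zB: "\<bar>s\<bar> \<le> B" if "s \<in> zeros (Suc n)" for s n
    using zeros_bounded[OF bdd that] by (simp add: B_def)
  have "tight gauss_measure"
    unfolding tight_def
  proof (intro conjI allI impI real_distribution_gauss_measure)
    fix \<epsilon> :: real assume "\<epsilon> > 0"
    have "zeros (Suc n) \<subseteq> {-B-1<..B}" for n
    proof
      fix s assume "s \<in> zeros (Suc n)"
      from zB[OF this] show "s \<in> {-B-1<..B}" by auto
    qed
    then have "measure (gauss_measure n) {-B-1<..B} = 1" for n
      by (intro measure_gauss_eq_1) auto
    with B \<open>\<epsilon> > 0\<close> show "\<exists>a b. a < b \<and> (\<forall>n. 1 - \<epsilon> < measure (gauss_measure n) {a<..b})"
      by (intro exI[of _ "-B-1"] exI[of _ B]) auto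
  qed
  from tight_imp_convergent_subsubsequence[OF this, of id]
  obtain r M where r: "strict_mono r" and M: "real_distribution M"
    and conv: "weak_conv_m (gauss_measure \<circ> r) M"
    by (auto simp: strict_mono_def)
  interpret M: real_distribution M by fact
  have lim: "(\<lambda>n. \<Sum>s\<in>zeros (Suc (r n)). f s / christoffel_kernel (r n) s s) \<longlonglongrightarrow> integral\<^sup>L M f"
    if "\<And>x. isCont f x" "\<And>x. \<bar>f x\<bar> \<le> C" for f :: "real \<Rightarrow> real" and C
  proof -
    have "(\<lambda>n. integral\<^sup>L ((gauss_measure \<circ> r) n) f) \<longlonglongrightarrow> integral\<^sup>L M f"
      by (rule weak_conv_imp_integral_bdd_continuous_conv[OF _ M conv, where B = C])
        (use that real_distribution_gauss_measure in auto)
    moreover have "f \<in> borel_measurable borel"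
      using that by (intro borel_measurable_continuous_onI continuous_at_imp_continuous_on) auto
    ultimately show ?thesis by (simp add: integral_gauss_measure)
  qed
  have supp: "AE x in M. \<bar>x\<bar> \<le> B"
  proof -
    \<comment> \<open>A bounded continuous function that vanishes exactly on the interval.\<close>
    define f where "f x = min 1 (max 0 (\<bar>x\<bar> - B))" for x :: real
    have fb: "0 \<le> f x" "\<bar>f x\<bar> \<le> 1" for x by (auto simp: f_def)
    have cf: "isCont f x" for x unfolding f_def by (intro continuous_intros)
    then have mf: "f \<in> borel_measurable borel"
      by (intro borel_measurable_continuous_onI continuous_at_imp_continuous_on) auto
    have "(\<lambda>n. \<Sum>s\<in>zeros (Suc (r n)). f s / christoffel_kernel (r n) s s) = (\<lambda>n. 0)"
      using zB by (intro ext sum.neutral) (auto simp: f_def)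
    with lim[OF cf fb(2)] have "integral\<^sup>L M f = 0" by (simp add: LIMSEQ_unique)
    moreover have "integrable M f" using fb mf by (intro M.integrable_const_bound[of _ 1]) auto
    ultimately have "AE x in M. f x = 0" using fb by (subst (asm) integral_nonneg_eq_0_iff_AE) auto
    then show ?thesis by eventually_elim (auto simp: f_def min_def max_def split: if_splits)
  qed
  have "(LINT x|M. poly (P k) x * poly (P l) x) = (if k = l then sqnorm k else 0)" for k l
  proof -
    \<comment> \<open>Clamping the argument makes the polynomial a bounded test function and changes neither integral.\<close>
    define clamp where "clamp x = max (-B) (min B x)" for x :: real
    define f where "f x = poly (P k) (clamp x) * poly (P l) (clamp x)" for x
    have cl: "clamp x \<in> {-B..B}" and cl_id: "\<bar>x\<bar> \<le> B \<Longrightarrow> clamp x = x" for x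
      using B by (auto simp: clamp_def)
    have "compact ((\<lambda>x. poly (P k) x * poly (P l) x) ` {-B..B})"
      by (intro compact_continuous_image continuous_intros) auto
    then have "bounded ((\<lambda>x. poly (P k) x * poly (P l) x) ` {-B..B})" by (rule compact_imp_bounded)
    then obtain C where "\<forall>x\<in>{-B..B}. \<bar>poly (P k) x * poly (P l) x\<bar> \<le> C"
      unfolding bounded_iff real_norm_def ball_simps by blast
    then have fC: "\<bar>f x\<bar> \<le> C" for x using cl unfolding f_def by blast
    have cf: "isCont f x" for x
      unfolding f_def clamp_def by (intro continuous_intros)
    have "eventually (\<lambda>n. (\<Sum>s\<in>zeros (Suc (r n)). f s / christoffel_kernel (r n) s s) = (if k = l then sqnorm k else 0)) sequentially"
      using eventually_ge_at_top[of "max k l"]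
    proof eventually_elim
      case (elim n)
      have "k \<le> r n" "l \<le> r n" using seq_suble[OF r, of n] elim by auto
      from gauss_quadrature[OF this] show ?case
        using zB by (simp add: f_def cl_id)
    qed
    then have "(\<lambda>n. \<Sum>s\<in>zeros (Suc (r n)). f s / christoffel_kernel (r n) s s) \<longlonglongrightarrow> (if k = l then sqnorm k else 0)"
      by (rule tendsto_eventually)
    with lim[OF cf fC] have "integral\<^sup>L M f = (if k = l then sqnorm k else 0)" by (rule LIMSEQ_unique)
    moreover have "integral\<^sup>L M f = (LINT x|M. poly (P k) x * poly (P l) x)"
    proof (rule integral_cong_AE)
      show "f \<in> borel_measurable M"
        using cf by (simp add: borel_measurable_continuous_onI continuous_at_imp_continuous_on)
      show "(\<lambda>x. poly (P k) x * poly (P l) x) \<in> borel_measurable M"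
        by (simp add: borel_measurable_continuous_onI continuous_intros)
      show "AE x in M. f x = poly (P k) x * poly (P l) x"
        using supp by eventually_elim (simp add: f_def cl_id)
    qed
    ultimately show ?thesis by simp
  qed
  then show ?thesis using M supp by blast
qed

end

section \<open>Weak limits of Turan determinants\<close>

lemma integral_cos_int:
  "integral {0..pi} (\<lambda>\<theta>. cos ((real i - real k) * \<theta>)) = (if i = k then pi else 0)"
proof (cases "i = k")
  case False
  define m where "m = real i - real k"
  have m: "m \<noteq> 0" using False by (simp add: m_def)
  have "m = real_of_int (int i - int k)" by (simp add: m_def)
  then have "sin (m * pi) = 0" unfolding sin_zero_iff_int2 by blast
  moreover have "((\<lambda>\<theta>. cos (m * \<theta>)) has_integral (sin (m * pi) / m - sin (m * 0) / m)) {0..pi}"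
    using m by (intro fundamental_theorem_of_calculus)
      (auto intro!: derivative_eq_intros simp: has_real_derivative_iff_has_vector_derivative[symmetric])
  ultimately show ?thesis using False by (simp add: m_def integral_unique)
qed simp

lemma cos_substitution:
  fixes g :: "real \<Rightarrow> real"
  assumes g: "continuous_on {-1..1} g"
  shows "integral {0..pi} (\<lambda>\<theta>. g (cos \<theta>) * (sin \<theta>)\<^sup>2) = integral {-1..1} (\<lambda>x. g x * sqrt (1 - x\<^sup>2))"
proof -
  let ?f = "\<lambda>x. g x * sqrt (1 - x\<^sup>2)"
  have "((\<lambda>\<theta>. (- sin \<theta>) *\<^sub>R ?f (cos \<theta>)) has_integral (integral {cos 0..cos pi} ?f - integral {cos pi..cos 0} ?f)) {0..pi}"
    by (rule has_integral_substitution_general[of "{}" 0 pi cos "-1" 1])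
      (auto intro!: continuous_intros g derivative_eq_intros)
  from integral_unique[OF this]
  have "integral {0..pi} (\<lambda>\<theta>. - (g (cos \<theta>) * (sin \<theta> * sqrt (1 - (cos \<theta>)\<^sup>2)))) = - integral {-1..1} ?f"
    by (simp add: mult_ac)
  moreover have "integral {0..pi} (\<lambda>\<theta>. - (g (cos \<theta>) * (sin \<theta> * sqrt (1 - (cos \<theta>)\<^sup>2))))
      = integral {0..pi} (\<lambda>\<theta>. - (g (cos \<theta>) * (sin \<theta>)\<^sup>2))"
    by (intro integral_cong) (simp add: sin_squared_eq[symmetric] sin_ge_zero power2_eq_square[symmetric])
  ultimately show ?thesis by simp
qed

lemma weierstrass_poly:
  fixes g :: "real \<Rightarrow> real"
  assumes "continuous_on {-A..A} g" "e > 0"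
  obtains f where "\<And>x. \<bar>x\<bar> \<le> A \<Longrightarrow> \<bar>g x - poly f x\<bar> < e"
proof -
  obtain u where u: "real_polynomial_function u" "\<And>x. x \<in> {-A..A} \<Longrightarrow> \<bar>g x - u x\<bar> < e"
    using Stone_Weierstrass_real_polynomial_function[OF _ assms] by auto
  then obtain a n where "u = (\<lambda>x. \<Sum>i\<le>n. a i * x ^ i)" unfolding real_polynomial_function_iff_sum by blast
  then have "u x = poly (\<Sum>i\<le>n. monom (a i) i) x" for x by (simp add: poly_sum poly_monom)
  with u(2) show ?thesis by (intro that[of "\<Sum>i\<le>n. monom (a i) i"]) (auto simp: abs_le_iff)
qed

locale bounded_distribution = real_distribution M for M :: "real measure" +
  fixes B :: real
  assumes support: "AE x in M. \<bar>x\<bar> \<le> B"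
begin

lemma continuous_integrable:
  fixes f :: "real \<Rightarrow> real"
  assumes "continuous_on UNIV f"
  shows "integrable M f"
proof -
  have "bounded (f ` {-B..B})"
    using continuous_on_subset[OF assms]
    by (intro compact_imp_bounded compact_continuous_image) auto
  then obtain C where C: "\<forall>x\<in>{-B..B}. norm (f x) \<le> C" unfolding bounded_iff ball_simps by blast
  have "AE x in M. norm (f x) \<le> C"
    using support by eventually_elim (use C in \<open>auto simp: abs_le_iff\<close>)
  then show ?thesis using assms by (intro integrable_const_bound[of _ C]) (simp_all add: borel_measurable_continuous_onI)
qed

end

text \<open>For a measure whose recurrence coefficients tend to those of the Chebyshev polynomials, the Turan
  determinants \<open>(p (n + 1))\<^sup>2 - p (n + 2) p n\<close> times the measure converge weakly to a multiple of the
  semicircle law, whatever the measure is.\<close>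

locale asymptotically_free = bounded_distribution +
  fixes p :: "nat \<Rightarrow> real \<Rightarrow> real" and \<beta> t H :: "nat \<Rightarrow> real" and T :: real
  assumes p_continuous: "\<And>k. continuous_on UNIV (p k)"
    and p_rec: "\<And>k x. 2 * x * p (Suc k) x = p (Suc (Suc k)) x + \<beta> (Suc k) * p (Suc k) x + t (Suc k) * p k x"
    and orth: "\<And>j k. (LINT x|M. p j x * p k x) = (if j = k then H j else 0)"
    and \<beta>_lim: "\<beta> \<longlonglongrightarrow> 0" and t_lim: "t \<longlonglongrightarrow> 1" and H_lim: "H \<longlonglongrightarrow> T"
begin

lemma integrable_p_p [simp]:
  assumes "continuous_on UNIV f"
  shows "integrable M (\<lambda>x. f x * (p j x * p k x))"
  by (intro continuous_integrable continuous_intros assms p_continuous)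

text \<open>Multiplication by \<open>x\<close> is represented in the basis \<open>p n\<close> by a matrix whose far entries tend to
  those of the free Jacobi matrix on the integers, which is diagonalised by \<open>x = cos \<theta>\<close>. Induction on
  the polynomial reduces the claim to one multiplication by \<open>x\<close>, that is, to the recurrence on the left
  and to the addition formula for the cosine on the right.\<close>

lemma matrix_element_limit:
  "(\<lambda>n. LINT x|M. poly f x * (p (n + i) x * p (n + k) x))
     \<longlonglongrightarrow> T / pi * integral {0..pi} (\<lambda>\<theta>. poly f (cos \<theta>) * cos ((real i - real k) * \<theta>))"
proof (induction f arbitrary: i k)
  case 0
  then show ?case by simp
next
  case (pCons a f)
  define A where "A i k = integral {0..pi} (\<lambda>\<theta>. poly f (cos \<theta>) * cos ((real i - real k) * \<theta>))" for i k
  define I where "I n i k = (LINT x|M. poly f x * (p (n + i) x * p (n + k) x))" for n i k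
  have IH: "(\<lambda>n. I n i k) \<longlonglongrightarrow> T / pi * A i k" for i k
    using pCons.IH[of i k] by (simp add: I_def A_def)
  have cf: "continuous_on UNIV (poly f)" by (intro continuous_intros)
  have A_cos: "integral {0..pi} (\<lambda>\<theta>. poly (pCons a f) (cos \<theta>) * cos ((real i - real (Suc k)) * \<theta>))
      = a * (if i = Suc k then pi else 0) + (A i (Suc (Suc k)) + A i k) / 2" for i k
  proof -
    have "integral {0..pi} (\<lambda>\<theta>. poly (pCons a f) (cos \<theta>) * cos ((real i - real (Suc k)) * \<theta>))
      = integral {0..pi} (\<lambda>\<theta>. a * cos ((real i - real (Suc k)) * \<theta>)
          + (poly f (cos \<theta>) * cos ((real i - real (Suc (Suc k))) * \<theta>)
             + poly f (cos \<theta>) * cos ((real i - real k) * \<theta>)) / 2)"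
    proof (rule integral_cong)
      fix \<theta> :: real
      have "2 * cos \<theta> * cos ((real i - real (Suc k)) * \<theta>)
          = cos ((real i - real (Suc (Suc k))) * \<theta>) + cos ((real i - real k) * \<theta>)"
        using cos_plus_cos[of "(real i - real (Suc (Suc k))) * \<theta>" "(real i - real k) * \<theta>"]
        by (simp add: algebra_simps diff_divide_distrib add_divide_distrib)
      then have *: "cos \<theta> * cos ((real i - real (Suc k)) * \<theta>)
          = (cos ((real i - real (Suc (Suc k))) * \<theta>) + cos ((real i - real k) * \<theta>)) / 2" by simp
      have "poly (pCons a f) (cos \<theta>) * cos ((real i - real (Suc k)) * \<theta>)
        = a * cos ((real i - real (Suc k)) * \<theta>) + poly f (cos \<theta>) * (cos \<theta> * cos ((real i - real (Suc k)) * \<theta>))"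
        by (simp add: algebra_simps)
      then show "poly (pCons a f) (cos \<theta>) * cos ((real i - real (Suc k)) * \<theta>)
        = a * cos ((real i - real (Suc k)) * \<theta>)
          + (poly f (cos \<theta>) * cos ((real i - real (Suc (Suc k))) * \<theta>)
             + poly f (cos \<theta>) * cos ((real i - real k) * \<theta>)) / 2"
        unfolding * by (simp add: algebra_simps add_divide_distrib)
    qed
    also have "\<dots> = a * integral {0..pi} (\<lambda>\<theta>. cos ((real i - real (Suc k)) * \<theta>)) + (A i (Suc (Suc k)) + A i k) / 2"
    proof -
      have F: "((\<lambda>\<theta>. a * cos (m * \<theta>)) has_integral a * integral {0..pi} (\<lambda>\<theta>. cos (m * \<theta>))) {0..pi}" for m
        by (intro has_integral_mult_right integrable_integral integrable_continuous_interval continuous_intros)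
      have G: "((\<lambda>\<theta>. poly f (cos \<theta>) * cos (m * \<theta>)) has_integral
          integral {0..pi} (\<lambda>\<theta>. poly f (cos \<theta>) * cos (m * \<theta>))) {0..pi}" for m
        by (intro integrable_integral integrable_continuous_interval continuous_intros)
      show ?thesis
        unfolding A_def by (intro integral_unique has_integral_add has_integral_divide F G)
    qed
    finally show ?thesis by (simp only: integral_cos_int)
  qed
  have shifted: "(\<lambda>n. LINT x|M. poly (pCons a f) x * (p (n + i) x * p (n + Suc k) x))
     \<longlonglongrightarrow> T / pi * integral {0..pi} (\<lambda>\<theta>. poly (pCons a f) (cos \<theta>) * cos ((real i - real (Suc k)) * \<theta>))" for i k
  proof -
    have eq: "(LINT x|M. poly (pCons a f) x * (p (n + i) x * p (n + Suc k) x))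
        = a * (if i = Suc k then H (n + i) else 0)
          + (I n i (Suc (Suc k)) + \<beta> (n + Suc k) * I n i (Suc k) + t (n + Suc k) * I n i k) / 2" for n
    proof -
      have "poly (pCons a f) x * (p (n + i) x * p (n + Suc k) x)
        = a * (p (n + i) x * p (n + Suc k) x)
          + (poly f x * (p (n + i) x * p (n + Suc (Suc k)) x)
            + \<beta> (n + Suc k) * (poly f x * (p (n + i) x * p (n + Suc k) x))
            + t (n + Suc k) * (poly f x * (p (n + i) x * p (n + k) x))) / 2" for x
      proof -
        have "poly (pCons a f) x * (p (n + i) x * p (n + Suc k) x)
          = a * (p (n + i) x * p (n + Suc k) x) + poly f x * p (n + i) x * (2 * x * p (Suc (n + k)) x) / 2"
          by (simp add: algebra_simps)
        then show ?thesis unfolding p_rec by (simp add: algebra_simps add_divide_distrib)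
      qed
      then show ?thesis
        using cf integrable_p_p[of "\<lambda>_. 1"] by (simp add: I_def orth)
    qed
    have "(\<lambda>n. a * (if i = Suc k then H (n + i) else 0)
          + (I n i (Suc (Suc k)) + \<beta> (n + Suc k) * I n i (Suc k) + t (n + Suc k) * I n i k) / 2)
      \<longlonglongrightarrow> a * (if i = Suc k then T else 0)
          + (T / pi * A i (Suc (Suc k)) + 0 * (T / pi * A i (Suc k)) + 1 * (T / pi * A i k)) / 2"
    proof (intro tendsto_add tendsto_mult tendsto_divide tendsto_const IH)
      show "(\<lambda>n. if i = Suc k then H (n + i) else 0) \<longlonglongrightarrow> (if i = Suc k then T else 0)"
        using LIMSEQ_ignore_initial_segment[OF H_lim, of i] by (cases "i = Suc k") auto
    qed (use LIMSEQ_ignore_initial_segment[OF \<beta>_lim, of "Suc k"] LIMSEQ_ignore_initial_segment[OF t_lim, of "Suc k"] in auto)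
    also have "a * (if i = Suc k then T else 0)
          + (T / pi * A i (Suc (Suc k)) + 0 * (T / pi * A i (Suc k)) + 1 * (T / pi * A i k)) / 2
       = T / pi * (a * (if i = Suc k then pi else 0) + (A i (Suc (Suc k)) + A i k) / 2)"
      by (simp add: field_simps)
    finally show ?thesis unfolding eq A_cos .
  qed
  \<comment> \<open>Moving both indices by one changes neither limit, so the second index may be taken positive.\<close>
  show ?case
    by (rule LIMSEQ_imp_Suc) (use shifted[of "Suc i" k] in simp)
qed

definition turan_det :: "nat \<Rightarrow> real \<Rightarrow> real" where
  "turan_det n x = (p (Suc n) x)\<^sup>2 - p (Suc (Suc n)) x * p n x"

lemma continuous_turan_det: "continuous_on UNIV (turan_det n)"
  unfolding turan_det_def by (intro continuous_intros p_continuous)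

text \<open>The determinant combines the matrix elements with index differences 0 and 2, so the limit has the
  density \<open>1 - cos (2 \<theta>) = 2 (sin \<theta>)\<^sup>2\<close> with respect to \<open>\<theta>\<close>.\<close>

lemma turan_det_limit_poly:
  "(\<lambda>n. LINT x|M. poly f x * turan_det n x)
     \<longlonglongrightarrow> 2 * T / pi * integral {-1..1} (\<lambda>x. poly f x * sqrt (1 - x\<^sup>2))"
proof -
  have cf: "continuous_on UNIV (poly f)" by (intro continuous_intros)
  have eq: "(LINT x|M. poly f x * turan_det n x)
      = (LINT x|M. poly f x * (p (n + 1) x * p (n + 1) x)) - (LINT x|M. poly f x * (p (n + 2) x * p (n + 0) x))" for n
    using cf by (subst Bochner_Integration.integral_diff[symmetric])
      (auto simp: turan_det_def power2_eq_square right_diff_distrib)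
  have "(\<lambda>n. LINT x|M. poly f x * turan_det n x)
     \<longlonglongrightarrow> T / pi * integral {0..pi} (\<lambda>\<theta>. poly f (cos \<theta>) * cos ((real 1 - real 1) * \<theta>))
        - T / pi * integral {0..pi} (\<lambda>\<theta>. poly f (cos \<theta>) * cos ((real 2 - real 0) * \<theta>))"
    unfolding eq by (intro tendsto_diff matrix_element_limit)
  also have "T / pi * integral {0..pi} (\<lambda>\<theta>. poly f (cos \<theta>) * cos ((real 1 - real 1) * \<theta>))
        - T / pi * integral {0..pi} (\<lambda>\<theta>. poly f (cos \<theta>) * cos ((real 2 - real 0) * \<theta>))
     = T / pi * integral {0..pi} (\<lambda>\<theta>. poly f (cos \<theta>) * cos ((real 1 - real 1) * \<theta>)
         - poly f (cos \<theta>) * cos ((real 2 - real 0) * \<theta>))"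
    by (subst integral_diff, (intro integrable_continuous_interval continuous_intros)+, simp only: right_diff_distrib)
  also have "\<dots> = T / pi * integral {0..pi} (\<lambda>\<theta>. 2 * (poly f (cos \<theta>) * (sin \<theta>)\<^sup>2))"
  proof -
    have "cos ((real 2 - real 0) * \<theta>) = 1 - 2 * (sin \<theta>)\<^sup>2" for \<theta>
      using cos_double_sin[of \<theta>] by simp
    then show ?thesis by (simp only:) (simp add: algebra_simps)
  qed
  also have "\<dots> = 2 * T / pi * integral {-1..1} (\<lambda>x. poly f x * sqrt (1 - x\<^sup>2))"
    unfolding integral_mult_right by (subst cos_substitution) (auto intro!: continuous_intros)
  finally show ?thesis .
qed

lemma turan_det_L1_bounded:
  obtains C where "\<And>n. (LINT x|M. \<bar>turan_det n x\<bar>) \<le> C" "C > 0"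
proof -
  have "Bseq H" using H_lim by (intro convergent_imp_Bseq convergentI)
  then obtain K where K: "K > 0" "\<And>n. \<bar>H n\<bar> \<le> K" by (auto elim!: BseqE)
  have i: "integrable M (\<lambda>x. p j x * p k x)" for j k
    by (intro continuous_integrable continuous_intros p_continuous)
  have "(LINT x|M. \<bar>turan_det n x\<bar>) \<le> 2 * K" for n
  proof -
    have pt: "\<bar>turan_det n x\<bar> \<le> p (Suc n) x * p (Suc n) x
        + (p (Suc (Suc n)) x * p (Suc (Suc n)) x + p n x * p n x) / 2" for x
    proof -
      have "2 * \<bar>p (Suc (Suc n)) x * p n x\<bar> \<le> \<bar>p (Suc (Suc n)) x\<bar>\<^sup>2 + \<bar>p n x\<bar>\<^sup>2"
        using sum_squares_bound[of "\<bar>p (Suc (Suc n)) x\<bar>" "\<bar>p n x\<bar>"] by (simp add: abs_mult)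
      moreover have "\<bar>turan_det n x\<bar> \<le> (p (Suc n) x)\<^sup>2 + \<bar>p (Suc (Suc n)) x * p n x\<bar>"
        unfolding turan_det_def by (metis abs_power2 abs_triangle_ineq4)
      moreover have "u \<le> a + b / 2" if "2 * v \<le> b" "u \<le> a + v" for u v a b :: real
        using that by linarith
      ultimately show ?thesis unfolding power2_abs unfolding power2_eq_square by blast
    qed
    have "(LINT x|M. \<bar>turan_det n x\<bar>) \<le> (LINT x|M. p (Suc n) x * p (Suc n) x
        + (p (Suc (Suc n)) x * p (Suc (Suc n)) x + p n x * p n x) / 2)"
      using pt by (intro integral_mono continuous_integrable continuous_intros p_continuous continuous_turan_det) auto
    also have "\<dots> = H (Suc n) + (H (Suc (Suc n)) + H n) / 2" by (simp add: i orth)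
    also have "\<dots> \<le> 2 * K"
    proof -
      have "H m \<le> K" for m using K(2)[of m] by (rule order_trans[OF abs_ge_self])
      from this[of n] this[of "Suc n"] this[of "Suc (Suc n)"] show ?thesis by (simp add: field_simps)
    qed
    finally show ?thesis .
  qed
  then show ?thesis using K that[of "2 * K"] by simp
qed

text \<open>The determinants are bounded in mean, so that Weierstrass approximation on an interval containing
  both the support of the measure and \<open>[-1, 1]\<close> passes from polynomials to continuous functions.\<close>

theorem turan_det_limit:
  fixes g :: "real \<Rightarrow> real"
  assumes g: "continuous_on UNIV g"
  shows "(\<lambda>n. LINT x|M. g x * turan_det n x)
     \<longlonglongrightarrow> 2 * T / pi * integral {-1..1} (\<lambda>x. g x * sqrt (1 - x\<^sup>2))"
proof (rule LIMSEQ_I)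
  fix e :: real assume "e > 0"
  obtain C where C: "\<And>n. (LINT x|M. \<bar>turan_det n x\<bar>) \<le> C" "C > 0" using turan_det_L1_bounded by blast
  define W where "W f = 2 * T / pi * integral {-1..1} (\<lambda>x. f x * sqrt (1 - x\<^sup>2))" for f :: "real \<Rightarrow> real"
  define K where "K = C + \<bar>2 * T / pi\<bar> * 2"
  define d where "d = e / (4 * K)"
  have K: "K > 0" using C(2) by (simp add: K_def add_pos_nonneg)
  have d: "d > 0" using \<open>e > 0\<close> K by (simp add: d_def)
  obtain f where f: "\<And>x. \<bar>x\<bar> \<le> max B 1 \<Longrightarrow> \<bar>g x - poly f x\<bar> < d"
    using weierstrass_poly[of "max B 1" g d] continuous_on_subset[OF g] d by blast
  have cf: "continuous_on UNIV (poly f)" by (intro continuous_intros)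
  have 1: "\<bar>(LINT x|M. g x * turan_det n x) - (LINT x|M. poly f x * turan_det n x)\<bar> \<le> d * C" for n
  proof -
    have "(LINT x|M. g x * turan_det n x) - (LINT x|M. poly f x * turan_det n x)
        = (LINT x|M. (g x - poly f x) * turan_det n x)"
      using cf g by (subst Bochner_Integration.integral_diff[symmetric])
        (auto simp: left_diff_distrib intro!: continuous_integrable continuous_intros continuous_turan_det)
    also have "\<bar>\<dots>\<bar> \<le> (LINT x|M. \<bar>(g x - poly f x) * turan_det n x\<bar>)" by (rule integral_abs_bound)
    also have "\<dots> \<le> (LINT x|M. d * \<bar>turan_det n x\<bar>)"
    proof (rule integral_mono_AE)
      show "integrable M (\<lambda>x. \<bar>(g x - poly f x) * turan_det n x\<bar>)" "integrable M (\<lambda>x. d * \<bar>turan_det n x\<bar>)"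
        by (intro continuous_integrable continuous_intros continuous_turan_det g cf)+
      show "AE x in M. \<bar>(g x - poly f x) * turan_det n x\<bar> \<le> d * \<bar>turan_det n x\<bar>"
        using support
      proof eventually_elim
        case (elim x)
        then have "\<bar>g x - poly f x\<bar> \<le> d" using f[of x] by (simp add: less_imp_le)
        then show ?case unfolding abs_mult by (rule mult_right_mono) simp
      qed
    qed
    also have "\<dots> = d * (LINT x|M. \<bar>turan_det n x\<bar>)" by simp
    also have "\<dots> \<le> d * C" using C d by (intro mult_left_mono) auto
    finally show ?thesis .
  qed
  have 2: "\<bar>W g - W (poly f)\<bar> \<le> \<bar>2 * T / pi\<bar> * (d * 2)"
  proof -
    have gi: "(\<lambda>x. g x * sqrt (1 - x\<^sup>2)) integrable_on {-1..1}" "(\<lambda>x. poly f x * sqrt (1 - x\<^sup>2)) integrable_on {-1..1}"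
      using continuous_on_subset[OF g] by (intro integrable_continuous_interval continuous_intros; simp)+
    have "W g - W (poly f) = 2 * T / pi * integral {-1..1} (\<lambda>x. (g x - poly f x) * sqrt (1 - x\<^sup>2))"
      unfolding W_def right_diff_distrib[symmetric] by (simp only: integral_diff[OF gi, symmetric] left_diff_distrib)
    moreover have "norm (integral {-1..1} (\<lambda>x. (g x - poly f x) * sqrt (1 - x\<^sup>2))) \<le> d * (1 - (-1))"
    proof (rule integral_bound)
      show "continuous_on {-1..1} (\<lambda>x. (g x - poly f x) * sqrt (1 - x\<^sup>2))"
        using continuous_on_subset[OF g] by (intro continuous_intros) auto
      fix x :: real assume x: "x \<in> {-1..1}"
      then have "\<bar>x\<bar> \<le> 1" by auto
      then have "x\<^sup>2 \<le> 1" by (simp add: abs_square_le_1)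
      then have "sqrt (1 - x\<^sup>2) \<le> 1" "0 \<le> sqrt (1 - x\<^sup>2)" by auto
      moreover have "\<bar>g x - poly f x\<bar> \<le> d" using f[of x] \<open>\<bar>x\<bar> \<le> 1\<close> by (simp add: less_imp_le)
      ultimately have "\<bar>g x - poly f x\<bar> * \<bar>sqrt (1 - x\<^sup>2)\<bar> \<le> d * 1" using d by (intro mult_mono) auto
      then show "norm ((g x - poly f x) * sqrt (1 - x\<^sup>2)) \<le> d" by (simp add: abs_mult)
    qed simp
    ultimately have 3: "W g - W (poly f) = 2 * T / pi * integral {-1..1} (\<lambda>x. (g x - poly f x) * sqrt (1 - x\<^sup>2))"
      and 4: "\<bar>integral {-1..1} (\<lambda>x. (g x - poly f x) * sqrt (1 - x\<^sup>2))\<bar> \<le> d * 2" by simp_all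
    show ?thesis unfolding 3 abs_mult[of "2 * T / pi"] using 4 by (rule mult_left_mono) simp
  qed
  have "\<exists>N. \<forall>n\<ge>N. norm ((LINT x|M. poly f x * turan_det n x) - W (poly f)) < e / 2"
    unfolding W_def using \<open>e > 0\<close> by (intro LIMSEQ_D turan_det_limit_poly) simp
  then obtain N where N: "\<And>n. n \<ge> N \<Longrightarrow> \<bar>(LINT x|M. poly f x * turan_det n x) - W (poly f)\<bar> < e / 2"
    unfolding real_norm_def by blast
  show "\<exists>N. \<forall>n\<ge>N. norm ((LINT x|M. g x * turan_det n x) - 2 * T / pi * integral {-1..1} (\<lambda>x. g x * sqrt (1 - x\<^sup>2))) < e"
  proof (intro exI allI impI)
    fix n assume "n \<ge> N"
    have "d * C + \<bar>2 * T / pi\<bar> * (d * 2) = d * K" by (simp add: K_def algebra_simps)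
    also have "\<dots> = e / 4" using K by (simp add: d_def)
    finally have "\<bar>(LINT x|M. g x * turan_det n x) - W g\<bar> < e"
      using 1[of n] 2 N[OF \<open>n \<ge> N\<close>] \<open>e > 0\<close> by linarith
    then show "norm ((LINT x|M. g x * turan_det n x) - 2 * T / pi * integral {-1..1} (\<lambda>x. g x * sqrt (1 - x\<^sup>2))) < e"
      by (simp add: W_def)
  qed
qed

end

section \<open>Recovering a density from weak limits\<close>

text \<open>A null set of greatest mass carries the whole singular part: outside it every further null set
  is negligible, so that Radon--Nikodym applies.\<close>

lemma lebesgue_decomposition:
  fixes M :: "real measure"
  assumes fin: "finite_measure M" and sets [measurable_cong]: "sets M = sets borel"
  obtains f N where "f \<in> borel_measurable borel" "N \<in> null_sets lborel"
    "\<And>A. A \<in> sets borel \<Longrightarrow> emeasure M A = emeasure (density lborel f) A + emeasure M (A \<inter> N)"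
proof -
  interpret M: finite_measure M by fact
  have sb: "A \<in> sets M \<longleftrightarrow> A \<in> sets borel" for A by (simp add: sets)
  define \<S> where "\<S> = emeasure M ` null_sets (lborel :: real measure)"
  have "\<S> \<noteq> {}" unfolding \<S>_def using null_sets.empty_sets by blast
  then obtain s :: "nat \<Rightarrow> ennreal" where s: "range s \<subseteq> \<S>" "Sup \<S> = (SUP i. s i)"
    using ennreal_Sup_countable_SUP[of \<S>] by auto
  then have "\<exists>N\<in>null_sets lborel. s i = emeasure M N" for i unfolding \<S>_def by blast
  then obtain n where n: "\<And>i. n i \<in> null_sets lborel" "\<And>i. s i = emeasure M (n i)" by metis
  define N where "N = (\<Union>i. n i)"
  have N: "N \<in> null_sets lborel" unfolding N_def using n by blast
  have nb: "A \<in> sets borel" if "A \<in> null_sets lborel" for A :: "real set"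
    using that by (auto simp: null_sets_def)
  have "Sup \<S> \<le> emeasure M N"
    unfolding s(2) n(2) using nb N by (intro SUP_least emeasure_mono) (auto simp: N_def sets)
  then have max: "emeasure M A \<le> emeasure M N" if "A \<in> null_sets lborel" for A
    using that by (auto simp: \<S>_def intro: order_trans[OF Sup_upper])
  define M' where "M' = density M (indicator (- N))"
  have em': "emeasure M' A = emeasure M (A - N)" if "A \<in> sets borel" for A
  proof -
    have "emeasure M' A = (\<integral>\<^sup>+ x. indicator (- N) x * indicator A x \<partial>M)"
      unfolding M'_def using that nb[OF N] by (intro emeasure_density) (auto simp: sets)
    also have "\<dots> = (\<integral>\<^sup>+ x. indicator (A - N) x \<partial>M)"
      by (intro nn_integral_cong) (auto split: split_indicator)
    also have "\<dots> = emeasure M (A - N)"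
      using that nb[OF N] by (intro nn_integral_indicator) (auto simp: sets)
    finally show ?thesis .
  qed
  have "absolutely_continuous lborel M'"
    unfolding absolutely_continuous_def
  proof
    fix A :: "real set" assume A: "A \<in> null_sets lborel"
    have "emeasure M N + emeasure M (A - N) = emeasure M (N \<union> (A - N))"
      using nb[OF A] nb[OF N] by (intro plus_emeasure) (auto simp: sets)
    also have "\<dots> \<le> emeasure M N + 0"
      using max[OF null_sets.Un[OF N A]] by simp
    finally have "emeasure M (A - N) = 0"
      using M.emeasure_finite[of N] by (simp add: ennreal_add_left_cancel_le)
    then show "A \<in> null_sets M'"
      using nb[OF A] em'[of A] by (auto simp: null_sets_def M'_def sets)
  qed
  then obtain f where f: "f \<in> borel_measurable lborel" "density lborel f = M'"
    using sigma_finite_measure.Radon_Nikodym[OF lborel.sigma_finite_measure_axioms, of M'] by (auto simp: M'_def sets)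
  show ?thesis
  proof (rule that[of f N])
    fix A :: "real set" assume A: "A \<in> sets borel"
    have "emeasure M ((A - N) \<union> (A \<inter> N)) = emeasure M (A - N) + emeasure M (A \<inter> N)"
      using A nb[OF N] by (intro plus_emeasure[symmetric]) (auto simp: sets)
    also have "(A - N) \<union> (A \<inter> N) = A" by blast
    finally show "emeasure M A = emeasure (density lborel f) A + emeasure M (A \<inter> N)"
      by (simp add: f(2) em'[OF A])
  qed (use f N in auto)
qed

text \<open>Continuous functions increasing to the indicator of the open interval from \<open>a\<close> to \<open>b\<close>, each
  vanishing near the end points and outside.\<close>

definition plateau :: "real \<Rightarrow> real \<Rightarrow> nat \<Rightarrow> real \<Rightarrow> real" where
  "plateau a b n x = min 1 (real n * max 0 (min (x - a) (b - x) - 1 / real (Suc n)))"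

lemma plateau_nonneg: "plateau a b n x \<ge> 0" and plateau_le_1: "plateau a b n x \<le> 1"
  by (auto simp: plateau_def)

lemma continuous_plateau: "continuous_on UNIV (plateau a b n)"
  unfolding plateau_def by (intro continuous_intros)

lemma plateau_support:
  assumes "plateau a b n x \<noteq> 0"
  shows "a + 1 / real (Suc n) \<le> x" "x \<le> b - 1 / real (Suc n)"
  using assms by (auto simp: plateau_def min_def max_def split: if_splits)

lemma plateau_mono: "incseq (\<lambda>n. plateau a b n x)"
proof (rule incseq_SucI)
  fix n
  have "1 / real (Suc (Suc n)) \<le> 1 / real (Suc n)" by (simp add: field_simps)
  then show "plateau a b n x \<le> plateau a b (Suc n) x"
    unfolding plateau_def by (intro min.mono mult_mono max.mono diff_mono order_refl) auto
qed

lemma plateau_tendsto: "(\<lambda>n. plateau a b n x) \<longlonglongrightarrow> indicator {a<..<b} x"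
proof (cases "x \<in> {a<..<b}")
  case True
  define m where "m = min (x - a) (b - x)"
  have m: "m > 0" using True by (auto simp: m_def)
  obtain k :: nat where k: "real k > 2 / m" using reals_Archimedean2 by blast
  have "eventually (\<lambda>n. plateau a b n x = 1) sequentially"
    using eventually_ge_at_top[of k]
  proof eventually_elim
    case (elim n)
    then have nm: "real n > 2 / m" using k by linarith
    then have n0: "real n * m > 2" using m by (simp add: pos_divide_less_eq)
    have "real n * (1 / real (Suc n)) \<le> 1" by simp
    with n0 have "real n * (m - 1 / real (Suc n)) \<ge> 1" by (simp only: right_diff_distrib)
    also have "real n * (m - 1 / real (Suc n)) \<le> real n * max 0 (m - 1 / real (Suc n))"
      by (intro mult_left_mono) auto
    finally show ?case by (simp add: plateau_def m_def)
  qed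
  then show ?thesis using True by (simp add: tendsto_eventually)
next
  case False
  have "plateau a b n x = 0" for n
  proof (rule ccontr)
    assume "plateau a b n x \<noteq> 0"
    moreover have "0 < 1 / real (Suc n)" by simp
    ultimately have "a < x" "x < b"
      using plateau_support[of a b n x] by linarith+
    with False show False by simp
  qed
  then show ?thesis using False by simp
qed

text \<open>Open intervals generate the Borel sets, and by monotone convergence the integrals of plateaus
  determine the measures of open intervals.\<close>

lemma measure_eq_from_plateaus:
  fixes M N :: "real measure"
  assumes sets [measurable_cong]: "sets M = sets borel" "sets N = sets borel"
    and fin: "emeasure N UNIV < \<infinity>"
    and carrier: "emeasure M (- {u<..<v}) = 0" "emeasure N (- {u<..<v}) = 0"
    and eq: "\<And>a b n. u \<le> a \<Longrightarrow> b \<le> v \<Longrightarrow>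
       (\<integral>\<^sup>+ x. ennreal (plateau a b n x) \<partial>M) = (\<integral>\<^sup>+ x. ennreal (plateau a b n x) \<partial>N)"
  shows "M = N"
proof -
  have conv: "(\<lambda>n. \<integral>\<^sup>+ x. ennreal (plateau a b n x) \<partial>L) \<longlonglongrightarrow> emeasure L {a<..<b}"
    if [measurable_cong]: "sets L = sets borel" for L :: "real measure" and a b
  proof -
    have [measurable]: "plateau a b n \<in> borel_measurable borel" for n
      by (intro borel_measurable_continuous_onI continuous_plateau)
    have "(\<lambda>n. \<integral>\<^sup>+ x. ennreal (plateau a b n x) \<partial>L) \<longlonglongrightarrow> (\<integral>\<^sup>+ x. indicator {a<..<b} x \<partial>L)"
    proof (rule nn_integral_LIMSEQ)
      show "incseq (\<lambda>n x. ennreal (plateau a b n x))"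
        using plateau_mono by (auto simp: mono_def le_fun_def intro!: ennreal_leI)
      show "(\<lambda>n. ennreal (plateau a b n x)) \<longlonglongrightarrow> indicator {a<..<b} x" for x
        using tendsto_ennrealI[OF plateau_tendsto[of a b x]] by (simp add: ennreal_indicator)
    qed measurable
    then show ?thesis using that by (simp add: sets_eq_imp_space_eq[OF that])
  qed
  have eq_cut: "emeasure M {a<..<b} = emeasure N {a<..<b}" if "u \<le> a" "b \<le> v" for a b
    using conv[OF sets(1), of a b] conv[OF sets(2), of a b] unfolding eq[OF that]
    by (rule LIMSEQ_unique)
  have eq_all: "emeasure M {a<..<b} = emeasure N {a<..<b}" for a b
  proof -
    have cut: "emeasure L {a<..<b} = emeasure L {max a u<..<min b v}"
      if "emeasure L (- {u<..<v}) = 0" "sets L = sets borel" for L :: "real measure"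
    proof (rule emeasure_eq_AE)
      have "- {u<..<v} \<in> null_sets L" using that by (auto simp: null_sets_def)
      then have "AE x in L. x \<in> {u<..<v}" by (rule AE_I'[of "- {u<..<v}"]) auto
      then show "AE x in L. (x \<in> {a<..<b}) = (x \<in> {max a u<..<min b v})" by eventually_elim auto
    qed (use that in auto)
    show ?thesis using cut[OF carrier(1) sets(1)] cut[OF carrier(2) sets(2)] eq_cut[of "max a u" "min b v"] by simp
  qed
  show ?thesis
  proof (rule measure_eqI_generator_eq[where E = "range (\<lambda>(a, b). {a<..<b::real})" and \<Omega> = UNIV
        and A = "\<lambda>i. {- real i<..<real i}"])
    show "Int_stable (range (\<lambda>(a, b). {a<..<b::real}))"
    proof (rule Int_stableI)
      fix X Y assume "X \<in> range (\<lambda>(a, b). {a<..<b::real})" "Y \<in> range (\<lambda>(a, b). {a<..<b::real})"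
      then obtain a b c d where "X = {a<..<b}" "Y = {c<..<d}" by auto
      then have "X \<inter> Y = (\<lambda>(a, b). {a<..<b}) (max a c, min b d)" by auto
      then show "X \<inter> Y \<in> range (\<lambda>(a, b). {a<..<b})" by (rule range_eqI)
    qed
    have "sets borel = sigma_sets UNIV (range (\<lambda>(a, b). {a<..<b::real}))"
      by (subst borel_eq_box) (simp add: split_beta)
    then show "sets M = sigma_sets UNIV (range (\<lambda>(a, b). {a<..<b::real}))"
      "sets N = sigma_sets UNIV (range (\<lambda>(a, b). {a<..<b::real}))"
      by (simp_all only: sets)
    show "(\<Union>i. {- real i<..<real i}) = UNIV"
    proof (intro UNIV_eq_I[symmetric] UNIV_eq_I)
      fix x :: real
      obtain i :: nat where "\<bar>x\<bar> < real i" using reals_Archimedean2 by blast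
      then show "x \<in> (\<Union>i. {- real i<..<real i})" by (intro UN_I[of i]) (auto simp: abs_less_iff)
    qed
    show "emeasure M {- real i<..<real i} \<noteq> \<infinity>" for i
    proof -
      have "emeasure N {- real i<..<real i} \<le> emeasure N UNIV" by (intro emeasure_mono) (auto simp: sets)
      with fin show ?thesis unfolding eq_all by (auto simp: top_unique)
    qed
  qed (use eq_all in auto)
qed

text \<open>Locally in the open interval, dominated convergence turns the weak limit of \<open>D n\<close> times \<open>M\<close> into
  \<open>\<Delta>\<close> times \<open>M\<close>, which therefore has the density \<open>w\<close>; as \<open>\<Delta>\<close> is positive, it can be divided out.\<close>

theorem density_from_weak_limit:
  fixes M :: "real measure" and D :: "nat \<Rightarrow> real \<Rightarrow> real" and w \<Delta> :: "real \<Rightarrow> real"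
  assumes "finite_measure M" and sets [measurable_cong]: "sets M = sets borel"
    and D: "\<And>n. continuous_on UNIV (D n)"
    and lim: "\<And>x. x \<in> {-1<..<1} \<Longrightarrow> (\<lambda>n. D n x) \<longlonglongrightarrow> \<Delta> x"
    and bdd: "\<And>d. d > 0 \<Longrightarrow> \<exists>K C. \<forall>n\<ge>K. \<forall>x. \<bar>x\<bar> \<le> 1 - d \<longrightarrow> \<bar>D n x\<bar> \<le> C"
    and pos: "\<And>x. x \<in> {-1<..<1} \<Longrightarrow> \<Delta> x > 0"
    and w: "continuous_on {-1..1} w" "\<And>x. x \<in> {-1..1} \<Longrightarrow> w x \<ge> 0"
    and weak: "\<And>g::real \<Rightarrow> real. continuous_on UNIV g \<Longrightarrow>
      (\<lambda>n. LINT x|M. g x * D n x) \<longlonglongrightarrow> integral {-1..1} (\<lambda>x. g x * w x)"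
  shows "(\<lambda>x. indicator {-1<..<1} x * ennreal (w x / \<Delta> x)) \<in> borel_measurable borel"
    and "\<And>A. A \<in> sets borel \<Longrightarrow> A \<subseteq> {-1<..<1} \<Longrightarrow>
      emeasure M A = emeasure (density lborel (\<lambda>x. indicator {-1<..<1} x * ennreal (w x / \<Delta> x))) A"
proof -
  interpret M: finite_measure M by fact
  let ?I = "{-1<..<1::real}"
  define \<Delta>' where "\<Delta>' x = indicator ?I x * \<Delta> x" for x
  define w' where "w' x = indicator ?I x * w x" for x
  have Dm [measurable]: "D n \<in> borel_measurable borel" for n
    using D by (rule borel_measurable_continuous_onI)
  have lim': "(\<lambda>n. indicator ?I x * D n x) \<longlonglongrightarrow> \<Delta>' x" for x
    unfolding \<Delta>'_def using lim[of x] by (cases "x \<in> ?I") (auto simp del: greaterThanLessThan_iff)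
  have \<Delta>'m [measurable]: "\<Delta>' \<in> borel_measurable borel"
    by (rule borel_measurable_LIMSEQ_real[OF lim']) measurable
  have w'm [measurable]: "w' \<in> borel_measurable borel"
    unfolding w'_def using borel_measurable_continuous_on_indicator[of ?I w] continuous_on_subset[OF w(1), of ?I]
    by (simp add: greaterThanLessThan_subseteq_atLeastAtMost_iff)
  have \<Delta>'0: "\<Delta>' x \<ge> 0" for x using pos[of x] by (auto simp: \<Delta>'_def indicator_def less_imp_le)
  have w'0: "w' x \<ge> 0" for x using w(2)[of x] by (auto simp: w'_def indicator_def)
  have dens: "indicator ?I x * ennreal (w x / \<Delta> x) = ennreal (w' x / \<Delta>' x)" for x
    by (auto simp: w'_def \<Delta>'_def indicator_def)
  show "(\<lambda>x. indicator ?I x * ennreal (w x / \<Delta> x)) \<in> borel_measurable borel"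
    unfolding dens by measurable
  \<comment> \<open>The measures \<open>\<Delta> M\<close> and \<open>w dx\<close> on the open interval, which the weak limit identifies.\<close>
  define M1 where "M1 = density M (\<lambda>x. ennreal (\<Delta>' x))"
  define M2 where "M2 = density lborel (\<lambda>x. ennreal (w' x))"
  have "M1 = M2"
  proof (rule measure_eq_from_plateaus[of M1 M2 "-1" 1])
    show "sets M1 = sets borel" "sets M2 = sets borel" by (simp_all add: M1_def M2_def sets)
    obtain C where C: "\<forall>x\<in>{-1..1}. norm (w x) \<le> C"
      using compact_imp_bounded[OF compact_continuous_image[OF w(1)]] unfolding bounded_iff ball_simps by blast
    have "emeasure M2 UNIV = (\<integral>\<^sup>+ x. ennreal (w' x) \<partial>lborel)"
      unfolding M2_def by (subst emeasure_density) auto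
    also have "\<dots> \<le> (\<integral>\<^sup>+ x. ennreal C * indicator {-1..1::real} x \<partial>lborel)"
      by (rule nn_integral_mono) (use C in \<open>auto simp: w'_def indicator_def abs_le_iff intro!: ennreal_leI\<close>)
    also have "\<dots> = ennreal C * ennreal (1 - (-1))"
      by (subst nn_integral_cmult_indicator) auto
    also have "\<dots> < \<infinity>" by (simp add: ennreal_mult_less_top)
    finally show "emeasure M2 UNIV < \<infinity>" .
    have z: "(\<integral>\<^sup>+ x. ennreal (k x) * indicator (- ?I) x \<partial>L) = 0" if "\<And>x. x \<notin> ?I \<Longrightarrow> k x = 0" for k and L :: "real measure"
    proof -
      have "(\<integral>\<^sup>+ x. ennreal (k x) * indicator (- ?I) x \<partial>L) = (\<integral>\<^sup>+ x. 0 \<partial>L)"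
        using that by (intro nn_integral_cong) (auto simp: indicator_def simp del: greaterThanLessThan_iff)
      then show ?thesis by simp
    qed
    have "(\<lambda>x. ennreal (\<Delta>' x)) \<in> borel_measurable M" "(\<lambda>x. ennreal (w' x)) \<in> borel_measurable lborel" by measurable
    moreover have "(\<integral>\<^sup>+ x. ennreal (\<Delta>' x) * indicator (- ?I) x \<partial>M) = 0"
      "(\<integral>\<^sup>+ x. ennreal (w' x) * indicator (- ?I) x \<partial>lborel) = 0"
      by (rule z; simp add: \<Delta>'_def w'_def)+
    ultimately show "emeasure M1 (- ?I) = 0" "emeasure M2 (- ?I) = 0"
      by (simp_all add: M1_def M2_def emeasure_density sets)
    fix a b :: real and n assume ab: "-1 \<le> a" "b \<le> 1"
    let ?g = "plateau a b n"
    have gm [measurable]: "?g \<in> borel_measurable borel"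
      by (intro borel_measurable_continuous_onI continuous_plateau)
    define d where "d = 1 / real (Suc n)"
    have d: "d > 0" by (simp add: d_def)
    have supp: "\<bar>x\<bar> \<le> 1 - d" if "?g x \<noteq> 0" for x
      using plateau_support[OF that] ab by (auto simp: d_def)
    obtain K C where C: "\<And>m x. m \<ge> K \<Longrightarrow> \<bar>x\<bar> \<le> 1 - d \<Longrightarrow> \<bar>D m x\<bar> \<le> C" using bdd[OF d] by metis
    have bound: "\<bar>?g x * D m x\<bar> \<le> \<bar>C\<bar>" if "m \<ge> K" for m x
    proof (cases "?g x = 0")
      case False
      have "\<bar>?g x\<bar> * \<bar>D m x\<bar> \<le> 1 * \<bar>C\<bar>"
        using plateau_nonneg[of a b n x] plateau_le_1[of a b n x] C[OF that supp[OF False]]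
        by (intro mult_mono) auto
      then show ?thesis by (simp add: abs_mult)
    qed simp
    have glim: "(\<lambda>m. ?g x * D m x) \<longlonglongrightarrow> ?g x * \<Delta>' x" for x
    proof (cases "?g x = 0")
      case False
      then have "x \<in> ?I" using supp[of x] d by auto
      then show ?thesis using lim[of x] by (intro tendsto_mult tendsto_const) (simp add: \<Delta>'_def)
    qed simp
    have dc: "(\<lambda>m. LINT x|M. ?g x * D (m + K) x) \<longlonglongrightarrow> (LINT x|M. ?g x * \<Delta>' x)"
      and int: "integrable M (\<lambda>x. ?g x * \<Delta>' x)"
    proof -
      have A: "(\<lambda>x. ?g x * \<Delta>' x) \<in> borel_measurable M" "\<And>m. (\<lambda>x. ?g x * D (m + K) x) \<in> borel_measurable M"
        "integrable M (\<lambda>x. \<bar>C\<bar>)" by simp_all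
      have Bb: "AE x in M. (\<lambda>m. ?g x * D (m + K) x) \<longlonglongrightarrow> ?g x * \<Delta>' x"
        using LIMSEQ_ignore_initial_segment[OF glim] by simp
      have Cc: "AE x in M. norm (?g x * D (m + K) x) \<le> \<bar>C\<bar>" for m
        using bound[of "m + K"] by simp
      show "(\<lambda>m. LINT x|M. ?g x * D (m + K) x) \<longlonglongrightarrow> (LINT x|M. ?g x * \<Delta>' x)"
        by (rule integral_dominated_convergence[OF A Bb Cc])
      show "integrable M (\<lambda>x. ?g x * \<Delta>' x)"
        by (rule integrable_dominated_convergence[OF A Bb Cc])
    qed
    have cw: "continuous_on {-1..1} (\<lambda>x. ?g x * w x)"
      using w(1) continuous_on_subset[OF continuous_plateau] by (intro continuous_intros) auto
    have "(LINT x|M. ?g x * \<Delta>' x) = integral {-1..1} (\<lambda>x. ?g x * w x)"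
      using LIMSEQ_unique[OF dc LIMSEQ_ignore_initial_segment[OF weak[OF continuous_plateau]]] .
    moreover have "(\<integral>\<^sup>+ x. ennreal (?g x) \<partial>M1) = ennreal (LINT x|M. ?g x * \<Delta>' x)"
    proof -
      have "(\<integral>\<^sup>+ x. ennreal (?g x) \<partial>M1) = (\<integral>\<^sup>+ x. ennreal (?g x * \<Delta>' x) \<partial>M)"
        unfolding M1_def using \<Delta>'0 plateau_nonneg
        by (subst nn_integral_density) (auto simp: ennreal_mult mult.commute sets)
      also have "\<dots> = ennreal (LINT x|M. ?g x * \<Delta>' x)"
        using \<Delta>'0 plateau_nonneg by (intro nn_integral_eq_integral int) auto
      finally show ?thesis .
    qed
    moreover have "(\<integral>\<^sup>+ x. ennreal (?g x) \<partial>M2) = ennreal (integral {-1..1} (\<lambda>x. ?g x * w x))"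
    proof -
      have "(\<integral>\<^sup>+ x. ennreal (?g x) \<partial>M2) = (\<integral>\<^sup>+ x. ennreal (?g x * w' x) \<partial>lborel)"
        unfolding M2_def using w'0 plateau_nonneg
        by (subst nn_integral_density) (auto simp: ennreal_mult mult.commute)
      also have "\<dots> = (\<integral>\<^sup>+ x. ennreal (?g x * w x) * indicator {-1..1} x \<partial>lborel)"
      proof (intro nn_integral_cong)
        fix x
        show "ennreal (?g x * w' x) = ennreal (?g x * w x) * indicator {-1..1} x"
        proof (cases "x \<in> ?I")
          case False
          have "\<not> \<bar>x\<bar> \<le> 1 - d" using False d by auto
          with supp[of x] have "?g x = 0" by blast
          then show ?thesis by simp
        qed (simp add: w'_def)
      qed
      also have "\<dots> = ennreal (integral {-1..1} (\<lambda>x. ?g x * w x))"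
      proof -
        have i: "set_integrable lborel {-1..1} (\<lambda>x. ?g x * w x)"
          using cw by (rule borel_integrable_atLeastAtMost')
        have "(\<integral>\<^sup>+ x. ennreal (?g x * w x) * indicator {-1..1} x \<partial>lborel)
            = (\<integral>\<^sup>+ x. ennreal (indicator {-1..1::real} x * (?g x * w x)) \<partial>lborel)"
          by (intro nn_integral_cong) (auto simp: indicator_def)
        also have "\<dots> = ennreal (LINT x|lborel. indicator {-1..1::real} x * (?g x * w x))"
          using i w(2) plateau_nonneg unfolding set_integrable_def
          by (intro nn_integral_eq_integral) (auto simp: indicator_def)
        also have "(LINT x|lborel. indicator {-1..1::real} x * (?g x * w x)) = integral {-1..1} (\<lambda>x. ?g x * w x)"
          using set_borel_integral_eq_integral(2)[OF i] by (simp add: set_lebesgue_integral_def)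
        finally show ?thesis .
      qed
      finally show ?thesis .
    qed
    ultimately show "(\<integral>\<^sup>+ x. ennreal (?g x) \<partial>M1) = (\<integral>\<^sup>+ x. ennreal (?g x) \<partial>M2)" by simp
  qed
  fix A assume A: "A \<in> sets borel" "A \<subseteq> ?I"
  have "(\<integral>\<^sup>+ x. ennreal (1 / \<Delta>' x) * indicator A x \<partial>M1) = (\<integral>\<^sup>+ x. ennreal (\<Delta>' x) * (ennreal (1 / \<Delta>' x) * indicator A x) \<partial>M)"
    unfolding M1_def using A by (intro nn_integral_density) (auto simp: sets)
  also have "\<dots> = (\<integral>\<^sup>+ x. indicator A x \<partial>M)"
  proof (intro nn_integral_cong)
    fix x
    show "ennreal (\<Delta>' x) * (ennreal (1 / \<Delta>' x) * indicator A x) = indicator A x"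
    proof (cases "x \<in> A")
      case True
      then have "\<Delta>' x > 0" using pos[of x] A by (auto simp: \<Delta>'_def)
      then have "ennreal (\<Delta>' x) * ennreal (1 / \<Delta>' x) = 1"
        by (subst ennreal_mult[symmetric]) auto
      with True show ?thesis by simp
    qed simp
  qed
  also have "\<dots> = emeasure M A" using A by (simp add: sets)
  finally have 1: "emeasure M A = (\<integral>\<^sup>+ x. ennreal (1 / \<Delta>' x) * indicator A x \<partial>M1)" by simp
  have "(\<integral>\<^sup>+ x. ennreal (1 / \<Delta>' x) * indicator A x \<partial>M2) = (\<integral>\<^sup>+ x. ennreal (w' x) * (ennreal (1 / \<Delta>' x) * indicator A x) \<partial>lborel)"
    unfolding M2_def using A by (intro nn_integral_density) auto
  also have "\<dots> = (\<integral>\<^sup>+ x. ennreal (w' x / \<Delta>' x) * indicator A x \<partial>lborel)"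
    using w'0 \<Delta>'0 by (intro nn_integral_cong) (simp add: mult.assoc[symmetric] ennreal_mult[symmetric])
  also have "\<dots> = emeasure (density lborel (\<lambda>x. ennreal (w' x / \<Delta>' x))) A"
    using A by (subst emeasure_density) auto
  finally show "emeasure M A = emeasure (density lborel (\<lambda>x. indicator ?I x * ennreal (w x / \<Delta> x))) A"
    unfolding dens 1 \<open>M1 = M2\<close> .
qed


text \<open>Where the measure is known to be absolutely continuous, its density may be prescribed at every
  point; elsewhere the Lebesgue decomposition supplies one.\<close>

lemma ac_component_density_extend:
  fixes M :: "real measure"
  assumes fin: "finite_measure M" and sets: "sets M = sets borel"
    and I: "I \<in> sets borel" and f0: "f0 \<in> borel_measurable borel"
    and ac: "\<And>A. A \<in> sets borel \<Longrightarrow> A \<subseteq> I \<Longrightarrow> emeasure M A = emeasure (density lborel f0) A"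
  shows "\<exists>f. ac_component_density M f \<and> (\<forall>x\<in>I. f x = f0 x)"
proof -
  interpret M: finite_measure M by fact
  obtain g N where g: "g \<in> borel_measurable borel" and N: "N \<in> null_sets lborel"
    and dec: "\<And>A. A \<in> sets borel \<Longrightarrow> emeasure M A = emeasure (density lborel g) A + emeasure M (A \<inter> N)"
    using lebesgue_decomposition[OF fin sets] by metis
  have Nb: "N \<in> sets borel" using N by (auto simp: null_sets_def)
  define f where "f x = (if x \<in> I then f0 x else g x)" for x
  define S where "S = density M (indicator (N - I))"
  have fm: "f \<in> borel_measurable borel"
    unfolding f_def using I f0 g by (intro measurable_If_set) auto
  have emS: "emeasure S A = emeasure M (A \<inter> (N - I))" if "A \<in> sets borel" for A
  proof -
    have "emeasure S A = (\<integral>\<^sup>+ x. indicator (N - I) x * indicator A x \<partial>M)"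
      unfolding S_def using that Nb I by (intro emeasure_density borel_measurable_indicator) (auto simp: sets)
    also have "\<dots> = (\<integral>\<^sup>+ x. indicator (A \<inter> (N - I)) x \<partial>M)"
      by (intro nn_integral_cong) (auto split: split_indicator)
    also have "\<dots> = emeasure M (A \<inter> (N - I))"
      using that Nb I by (intro nn_integral_indicator) (auto simp: sets)
    finally show ?thesis .
  qed
  have split: "emeasure L A = emeasure L (A \<inter> I) + emeasure L (A - I)"
    if "A \<in> sets borel" "sets L = sets borel" for A and L :: "real measure"
  proof -
    have "emeasure L (A \<inter> I) + emeasure L (A - I) = emeasure L ((A \<inter> I) \<union> (A - I))"
      using that I by (intro plus_emeasure) auto
    also have "(A \<inter> I) \<union> (A - I) = A" by blast
    finally show ?thesis by simp
  qed
  have cong: "emeasure (density lborel u) A = emeasure (density lborel v) A"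
    if "A \<in> sets borel" "u \<in> borel_measurable borel" "v \<in> borel_measurable borel" "\<And>x. x \<in> A \<Longrightarrow> u x = v x"
    for u v :: "real \<Rightarrow> ennreal" and A
    using that by (simp add: emeasure_density) (intro nn_integral_cong, auto split: split_indicator)
  have "emeasure M A = emeasure (density lborel f) A + emeasure S A" if A: "A \<in> sets borel" for A
  proof -
    have AI: "A \<inter> I \<in> sets borel" "A - I \<in> sets borel" using A I by auto
    have "emeasure M A = emeasure M (A \<inter> I) + emeasure M (A - I)" by (rule split[OF A sets])
    also have "emeasure M (A \<inter> I) = emeasure (density lborel f) (A \<inter> I)"
      using AI ac[of "A \<inter> I"] cong[OF AI(1) f0 fm] by (simp add: f_def)
    also have "emeasure M (A - I) = emeasure (density lborel f) (A - I) + emeasure M ((A - I) \<inter> N)"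
      using dec[OF AI(2)] cong[OF AI(2) g fm] by (simp add: f_def)
    also have "(A - I) \<inter> N = A \<inter> (N - I)" by blast
    also have "emeasure M (A \<inter> (N - I)) = emeasure S A" by (simp add: emS A)
    finally show ?thesis
      using split[OF A, of "density lborel f"] by (simp add: add.assoc)
  qed
  moreover have "mutually_singular S lborel"
    unfolding mutually_singular_def
  proof (intro conjI bexI)
    have "- N \<inter> (N - I) = {}" by blast
    then show "emeasure S (- N) = 0" using Nb emS[of "- N"] by simp
    show "emeasure lborel (space lborel - - N) = 0" using N by (auto simp: null_sets_def)
  qed (use Nb in \<open>auto simp: S_def sets\<close>)
  ultimately have "ac_component_density M f"
    unfolding ac_component_density_def using fm by auto
  then show ?thesis by (intro exI[of _ f]) (simp add: f_def)
qed

section \<open>The Jost solution of the q-recurrence\<close>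

lemma q_rising_0 [simp]: "q_rising a q 0 = 1"
  and q_rising_Suc: "q_rising a q (Suc n) = q_rising a q n * (1 - a * q ^ n)"
  by (simp_all add: q_rising_def)

text \<open>The polynomials are rescaled to \<open>p x n = 2 ^ n P n (x)\<close>, which have Chebyshev polynomials of the
  second kind as their unperturbed counterpart, and \<open>r\<close> stands for \<open>\<lambda> / b\<close>.\<close>

locale q_recurrence =
  fixes q c r :: real
  assumes q_less_1: "\<bar>q\<bar> < 1"
    and t_pos': "\<And>k. 1 + r * q ^ Suc k > 0"
begin

definition t :: "nat \<Rightarrow> real" where "t k = 1 + r * q ^ k"

fun p :: "real \<Rightarrow> nat \<Rightarrow> real" where
  "p x 0 = 1"
| "p x (Suc 0) = 2 * x - 2 * c"
| "p x (Suc (Suc k)) = (2 * x - 2 * c * q ^ Suc k) * p x (Suc k) - t (Suc k) * p x k"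

lemma t_pos: "t (Suc k) > 0"
  using t_pos' by (simp add: t_def)

definition jost_coeff :: "complex \<Rightarrow> nat \<Rightarrow> complex" where
  "jost_coeff z m =
     (\<Prod>j<m. - 2 * of_real c - of_real r * of_real q ^ Suc j * z) * z ^ m * of_real q ^ (m choose 2)
     / (q_rising (of_real q) (of_real q) m * q_rising (of_real q * z\<^sup>2) (of_real q) m)"

lemma jost_coeff_0 [simp]: "jost_coeff z 0 = 1"
  by (simp add: jost_coeff_def numeral_2_eq_2)

text \<open>At \<open>k = 0\<close> this is the series that defines \<open>R\<close>. The parameter \<open>k\<close> replaces \<open>(c, r)\<close> by
  \<open>(c q ^ k, r q ^ k)\<close>, which are the parameters of the recurrence with its first \<open>k\<close> steps removed.
  The sequence \<open>z ^ k * jost z (k + 1)\<close> is the Jost solution of the adjoint of the recurrence for \<open>p\<close>: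
  the one that behaves as \<open>z ^ k\<close> at infinity.\<close>

definition jost :: "complex \<Rightarrow> nat \<Rightarrow> complex" where
  "jost z k = (\<Sum>m. jost_coeff z m * (of_real q ^ k) ^ m)"

text \<open>Keeps the denominators of the series away from 0 for every \<open>z\<close> on the unit circle, including
  \<open>z\<^sup>2 = 1\<close>; this is what makes the later estimates uniform in \<open>z\<close>.\<close>

lemma norm_one_minus_ge:
  assumes "cmod w \<le> 1"
  shows "1 - \<bar>q\<bar> \<le> cmod (1 - of_real q ^ Suc m * w)"
proof -
  have "cmod (of_real q ^ Suc m * w) \<le> \<bar>q\<bar> ^ Suc m * 1"
    unfolding norm_mult norm_power norm_of_real using assms by (intro mult_left_mono) auto
  also have "\<dots> \<le> \<bar>q\<bar> ^ 1 * 1" using q_less_1 by (intro mult_right_mono power_decreasing) auto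
  finally have "cmod (of_real q ^ Suc m * w) \<le> \<bar>q\<bar>" by simp
  moreover have "1 - cmod (of_real q ^ Suc m * w) \<le> cmod (1 - of_real q ^ Suc m * w)"
    by (metis norm_one norm_triangle_ineq2)
  ultimately show ?thesis by linarith
qed

lemma jost_coeff_Suc_divide:
  "jost_coeff z (Suc m) = jost_coeff z m *
     ((- 2 * of_real c - of_real r * of_real q ^ Suc m * z) * z * of_real q ^ m)
     / ((1 - of_real q ^ Suc m) * (1 - of_real q ^ Suc m * z\<^sup>2))"
proof -
  have "Suc m choose 2 = (m choose 2) + m" by (simp add: numeral_2_eq_2)
  then show ?thesis
    by (simp add: jost_coeff_def q_rising_Suc power_add mult_ac)
qed

lemma jost_coeff_Suc:
  assumes "cmod z = 1"
  shows "jost_coeff z (Suc m) * ((1 - of_real q ^ Suc m) * (1 - of_real q ^ Suc m * z\<^sup>2))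
    = jost_coeff z m * ((- 2 * of_real c - of_real r * of_real q ^ Suc m * z) * z * of_real q ^ m)"
proof -
  have "cmod (1 - of_real q ^ Suc m * 1) > 0" "cmod (1 - of_real q ^ Suc m * z\<^sup>2) > 0"
    using norm_one_minus_ge[of 1 m] norm_one_minus_ge[of "z\<^sup>2" m] q_less_1 assms
    by (auto simp: norm_power simp del: power_Suc)
  then have "1 - of_real q ^ Suc m \<noteq> (0::complex)" "1 - of_real q ^ Suc m * z\<^sup>2 \<noteq> 0" by auto
  then show ?thesis by (simp add: jost_coeff_Suc_divide del: power_Suc)
qed

text \<open>Majorises the coefficients of the series uniformly on the unit circle; the factors \<open>q ^ j\<close> come from
  \<open>q ^ (m choose 2)\<close> and make it summable.\<close>

definition major :: "nat \<Rightarrow> real" where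
  "major m = (\<Prod>j<m. (2 * \<bar>c\<bar> + \<bar>r\<bar>) * \<bar>q\<bar> ^ j / (1 - \<bar>q\<bar>)\<^sup>2)"

lemma major_nonneg: "major m \<ge> 0"
  by (auto simp: major_def intro!: prod_nonneg)

lemma summable_major: "summable major"
proof -
  define K where "K = (2 * \<bar>c\<bar> + \<bar>r\<bar>) / (1 - \<bar>q\<bar>)\<^sup>2"
  have "(\<lambda>m. K * \<bar>q\<bar> ^ m) \<longlonglongrightarrow> K * 0"
    using q_less_1 by (intro tendsto_mult tendsto_const LIMSEQ_power_zero) auto
  then have "eventually (\<lambda>m. K * \<bar>q\<bar> ^ m < 1 / 2) sequentially"
    by (intro order_tendstoD(2)[where y = "K * 0"]) auto
  then obtain N where N: "\<And>m. m \<ge> N \<Longrightarrow> K * \<bar>q\<bar> ^ m < 1 / 2"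
    by (auto simp: eventually_sequentially)
  show ?thesis
  proof (rule summable_ratio_test[of "1 / 2" N])
    fix m assume "m \<ge> N"
    have "major (Suc m) = (K * \<bar>q\<bar> ^ m) * major m" by (simp add: major_def K_def)
    also have "\<dots> \<le> 1 / 2 * major m"
      using N[OF \<open>m \<ge> N\<close>] major_nonneg by (intro mult_right_mono) auto
    finally show "norm (major (Suc m)) \<le> 1 / 2 * norm (major m)" using major_nonneg by simp
  qed simp
qed

lemma norm_jost_coeff:
  assumes z: "cmod z = 1"
  shows "cmod (jost_coeff z m) \<le> major m"
proof (induction m)
  case 0
  then show ?case by (simp add: major_def)
next
  case (Suc m)
  have "cmod (of_real r * of_real q ^ Suc m * z) \<le> \<bar>r\<bar> * 1"
    unfolding norm_mult norm_power norm_of_real z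
    using q_less_1 by (simp add: mult_left_le power_le_one mult_le_one del: power_Suc)
  then have num: "cmod (- 2 * of_real c - of_real r * of_real q ^ Suc m * z) \<le> 2 * \<bar>c\<bar> + \<bar>r\<bar>"
    by (intro order_trans[OF norm_triangle_ineq4] add_mono) (auto simp: norm_mult)
  have den: "(1 - \<bar>q\<bar>) * (1 - \<bar>q\<bar>) \<le> cmod (1 - of_real q ^ Suc m * 1) * cmod (1 - of_real q ^ Suc m * z\<^sup>2)"
    using q_less_1 z by (intro mult_mono norm_one_minus_ge) (auto simp: norm_power)
  have "cmod (jost_coeff z (Suc m)) = cmod (jost_coeff z m) *
     (cmod (- 2 * of_real c - of_real r * of_real q ^ Suc m * z) * \<bar>q\<bar> ^ m)
     / (cmod (1 - of_real q ^ Suc m * 1) * cmod (1 - of_real q ^ Suc m * z\<^sup>2))"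
    unfolding jost_coeff_Suc_divide by (simp add: norm_mult norm_divide norm_power z)
  also have "\<dots> \<le> major m * ((2 * \<bar>c\<bar> + \<bar>r\<bar>) * \<bar>q\<bar> ^ m) / ((1 - \<bar>q\<bar>) * (1 - \<bar>q\<bar>))"
  proof (rule frac_le)
    show "cmod (jost_coeff z m) * (cmod (- 2 * of_real c - of_real r * of_real q ^ Suc m * z) * \<bar>q\<bar> ^ m)
        \<le> major m * ((2 * \<bar>c\<bar> + \<bar>r\<bar>) * \<bar>q\<bar> ^ m)"
      using num Suc.IH major_nonneg by (intro mult_mono mult_right_mono) auto
  qed (use den q_less_1 major_nonneg in auto)
  finally show ?case by (simp add: major_def power2_eq_square)
qed

lemma summable_jost:
  assumes z: "cmod z = 1" and s: "cmod s \<le> 1"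
  shows "summable (\<lambda>m. jost_coeff z m * s ^ m)"
proof (rule summable_comparison_test'[OF summable_major, of 0])
  fix m
  have "cmod (jost_coeff z m) * cmod s ^ m \<le> major m * 1"
    using norm_jost_coeff[OF z] s major_nonneg by (intro mult_mono power_le_one) auto
  then show "norm (jost_coeff z m * s ^ m) \<le> major m" by (simp add: norm_mult norm_power)
qed

lemma norm_q_power_le: "cmod (of_real q ^ k) \<le> 1"
  using q_less_1 by (simp add: norm_power power_le_one)

lemma norm_jost_minus_1:
  assumes z: "cmod z = 1"
  shows "cmod (jost z k - 1) \<le> suminf major * \<bar>q\<bar> ^ k"
proof -
  let ?s = "of_real q ^ k :: complex"
  have sm: "summable (\<lambda>m. jost_coeff z m * ?s ^ m)" by (rule summable_jost[OF z norm_q_power_le])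
  have sM: "summable (\<lambda>m. major (Suc m))" using summable_major by (subst summable_Suc_iff)
  have "jost z k - 1 = (\<Sum>m. jost_coeff z (Suc m) * ?s ^ Suc m)"
    unfolding jost_def using suminf_split_head[OF sm] by simp
  also have "cmod \<dots> \<le> (\<Sum>m. major (Suc m) * \<bar>q\<bar> ^ k)"
  proof (rule norm_suminf_le)
    show "norm (jost_coeff z (Suc m) * ?s ^ Suc m) \<le> major (Suc m) * \<bar>q\<bar> ^ k" for m
    proof -
      have "cmod ?s ^ Suc m \<le> cmod ?s ^ 1"
        using norm_q_power_le by (intro power_decreasing) auto
      then have "cmod (jost_coeff z (Suc m)) * cmod ?s ^ Suc m \<le> major (Suc m) * cmod ?s ^ 1"
        using norm_jost_coeff[OF z] major_nonneg by (intro mult_mono) auto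
      then show ?thesis by (simp only: norm_mult norm_power norm_of_real power_one_right)
    qed
    show "summable (\<lambda>m. major (Suc m) * \<bar>q\<bar> ^ k)" using sM by (rule summable_mult2)
  qed
  also have "\<dots> = (\<Sum>m. major (Suc m)) * \<bar>q\<bar> ^ k" by (rule suminf_mult2[symmetric]) (rule sM)
  also have "\<dots> \<le> suminf major * \<bar>q\<bar> ^ k"
    using suminf_split_head[OF summable_major] major_nonneg[of 0] by (intro mult_right_mono) auto
  finally show ?thesis .
qed

text \<open>Comparing the coefficients of \<open>(q ^ k) ^ m\<close> on both sides leaves exactly the two-term recursion
  \<open>jost_coeff_Suc\<close>.\<close>

lemma jost_recurrence:
  assumes z: "cmod z = 1"
  shows "(z\<^sup>2 + 1 - 2 * of_real (c * q ^ k) * z) * jost z (Suc k)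
    = of_real (t (Suc k)) * z\<^sup>2 * jost z (Suc (Suc k)) + jost z k"
proof -
  define s where "s = (of_real q ^ k :: complex)"
  define g where "g = jost_coeff z"
  define Q where "Q = (of_real q :: complex)"
  have s1: "cmod s \<le> 1" "cmod (Q * s) \<le> 1" "cmod (Q * (Q * s)) \<le> 1"
    using norm_q_power_le[of k] norm_q_power_le[of "Suc k"] norm_q_power_le[of "Suc (Suc k)"]
    by (simp_all add: s_def Q_def)
  have sum0: "summable (\<lambda>m. g m * s ^ m)" and sum1: "summable (\<lambda>m. g m * (Q * s) ^ m)"
    and sum2: "summable (\<lambda>m. g m * (Q * (Q * s)) ^ m)"
    using summable_jost[OF z s1(1)] summable_jost[OF z s1(2)] summable_jost[OF z s1(3)] by (simp_all add: g_def)
  have J: "jost z k = (\<Sum>m. g m * s ^ m)" "jost z (Suc k) = (\<Sum>m. g m * (Q * s) ^ m)"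
    "jost z (Suc (Suc k)) = (\<Sum>m. g m * (Q * (Q * s)) ^ m)"
    by (simp_all add: jost_def s_def g_def Q_def)
  have T: "of_real (t (Suc k)) = 1 + of_real r * (Q * s)"
    by (simp add: t_def Q_def s_def)
  define L where "L m = (z\<^sup>2 + 1) * (g m * (Q * s) ^ m) - z\<^sup>2 * (g m * (Q * (Q * s)) ^ m) - g m * s ^ m" for m
  define U where "U m = (2 * of_real c * s * z) * (g m * (Q * s) ^ m)
      + of_real r * (Q * s) * z\<^sup>2 * (g m * (Q * (Q * s)) ^ m)" for m
  have L: "L sums ((z\<^sup>2 + 1) * jost z (Suc k) - z\<^sup>2 * jost z (Suc (Suc k)) - jost z k)"
    unfolding L_def J by (intro sums_diff sums_mult summable_sums sum0 sum1 sum2)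
  have U: "U sums ((2 * of_real c * s * z) * jost z (Suc k) + of_real r * (Q * s) * z\<^sup>2 * jost z (Suc (Suc k)))"
    unfolding U_def J by (intro sums_add sums_mult summable_sums sum0 sum1 sum2)
  have "L 0 = 0" by (simp add: L_def algebra_simps)
  moreover have "L (Suc m) = U m" for m
  proof -
    have "L (Suc m) = - (g (Suc m) * ((1 - Q ^ Suc m) * (1 - Q ^ Suc m * z\<^sup>2))) * s ^ Suc m"
      unfolding L_def power_mult_distrib by (simp add: algebra_simps)
    also have "\<dots> = U m"
      unfolding U_def g_def Q_def jost_coeff_Suc[OF z] power_mult_distrib
      by (simp add: algebra_simps power2_eq_square)
    finally show ?thesis .
  qed
  ultimately have "L sums suminf U"
    using U sums_Suc_iff[of L "suminf U"] by (simp add: sums_iff)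
  with L U have "(z\<^sup>2 + 1) * jost z (Suc k) - z\<^sup>2 * jost z (Suc (Suc k)) - jost z k
    = (2 * of_real c * s * z) * jost z (Suc k) + of_real r * (Q * s) * z\<^sup>2 * jost z (Suc (Suc k))"
    by (metis sums_unique2 sums_unique)
  then show ?thesis unfolding T by (simp add: s_def algebra_simps)
qed

text \<open>The recurrences of the polynomials and of \<open>jost z\<close> are adjoint to each other, so that a discrete
  Wronskian of the two solutions is independent of \<open>k\<close>. As the polynomials vanish at index \<open>-1\<close> and
  equal 1 at index 0, its constant value is the series at \<open>k = 0\<close>.\<close>

lemma wronskian:
  assumes z: "cmod z = 1"
  shows "z ^ Suc k * (of_real (p (Re z) (Suc k)) * jost z (Suc k)
           - of_real (t (Suc k)) * z * of_real (p (Re z) k) * jost z (Suc (Suc k))) = jost z 0"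
proof -
  have "2 * of_real (Re z) * z = z * z + cnj z * z"
    using complex_add_cnj[of z] by (simp add: distrib_right[symmetric])
  also have "cnj z * z = 1" using z by (metis complex_norm_square mult.commute of_real_1 one_power2)
  finally have zz: "2 * of_real (Re z) * z = z\<^sup>2 + 1" by (simp add: power2_eq_square)
  show ?thesis
  proof (induction k)
    case 0
    have "z * (of_real (2 * Re z - 2 * c) * jost z (Suc 0) - of_real (t (Suc 0)) * z * jost z (Suc (Suc 0)))
       = (2 * of_real (Re z) * z - 2 * of_real c * z) * jost z (Suc 0) - of_real (t (Suc 0)) * z\<^sup>2 * jost z (Suc (Suc 0))"
      by (simp add: algebra_simps power2_eq_square)
    then show ?case unfolding zz using jost_recurrence[OF z, of 0] by (simp add: algebra_simps power2_eq_square)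
  next
    case (Suc k)
    let ?p = "p (Re z)"
    have "z * (of_real (?p (Suc (Suc k))) * jost z (Suc (Suc k))
           - of_real (t (Suc (Suc k))) * z * of_real (?p (Suc k)) * jost z (Suc (Suc (Suc k))))
       = of_real (?p (Suc k)) * ((2 * of_real (Re z) * z - 2 * of_real (c * q ^ Suc k) * z) * jost z (Suc (Suc k))
            - of_real (t (Suc (Suc k))) * z\<^sup>2 * jost z (Suc (Suc (Suc k))))
         - z * of_real (t (Suc k)) * of_real (?p k) * jost z (Suc (Suc k))"
      by (simp add: algebra_simps power2_eq_square)
    also have "\<dots> = of_real (?p (Suc k)) * jost z (Suc k) - of_real (t (Suc k)) * z * of_real (?p k) * jost z (Suc (Suc k))"
      unfolding zz using jost_recurrence[OF z, of "Suc k"] by (simp add: algebra_simps)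
    finally show ?case using Suc.IH by (simp only: power_Suc2[of z "Suc k"] mult.assoc)
  qed
qed


definition jost_bound :: real where "jost_bound = suminf major"
definition err_const :: real where "err_const = jost_bound + \<bar>r\<bar> * (1 + jost_bound)"

lemma jost_bound_nonneg: "jost_bound \<ge> 0"
  unfolding jost_bound_def using summable_major major_nonneg by (intro suminf_nonneg)

lemma norm_jost_le: "cmod z = 1 \<Longrightarrow> cmod (jost z k) \<le> 1 + jost_bound"
proof -
  assume z: "cmod z = 1"
  have "\<bar>q\<bar> ^ k \<le> 1" using q_less_1 by (simp add: power_le_one)
  then have "jost_bound * \<bar>q\<bar> ^ k \<le> jost_bound * 1" using jost_bound_nonneg by (intro mult_left_mono) auto
  moreover have "cmod (jost z k) \<le> cmod 1 + cmod (jost z k - 1)"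
    by (metis add.commute diff_add_cancel norm_triangle_ineq)
  ultimately show ?thesis using norm_jost_minus_1[OF z, of k] by (simp add: jost_bound_def)
qed

lemma wronskian_norm:
  assumes z: "cmod z = 1"
  shows "cmod (of_real (p (Re z) (Suc k)) * jost z (Suc k)
           - of_real (t (Suc k)) * z * of_real (p (Re z) k) * jost z (Suc (Suc k))) = cmod (jost z 0)"
  using arg_cong[OF wronskian[OF z, of k], of cmod] by (simp only: norm_mult norm_power z power_one mult_1)

text \<open>Since \<open>jost z k\<close> and \<open>t k\<close> tend to 1 geometrically, the Wronskian is close to the one of the
  unperturbed recurrence.\<close>

lemma free_wronskian_error:
  assumes z: "cmod z = 1"
  shows "cmod ((of_real (p (Re z) (Suc k)) * jost z (Suc k)
           - of_real (t (Suc k)) * z * of_real (p (Re z) k) * jost z (Suc (Suc k)))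
           - (of_real (p (Re z) (Suc k)) - z * of_real (p (Re z) k)))
     \<le> err_const * \<bar>q\<bar> ^ k * (\<bar>p (Re z) (Suc k)\<bar> + \<bar>p (Re z) k\<bar>)" (is "cmod ?d \<le> _")
proof -
  define a b where "a = p (Re z) (Suc k)" and "b = p (Re z) k"
  have mono: "\<bar>q\<bar> ^ Suc k \<le> \<bar>q\<bar> ^ k" "\<bar>q\<bar> ^ Suc (Suc k) \<le> \<bar>q\<bar> ^ k"
    using q_less_1 by (intro power_decreasing; simp)+
  have "cmod (jost z (Suc k) - 1) \<le> jost_bound * \<bar>q\<bar> ^ Suc k"
    unfolding jost_bound_def by (rule norm_jost_minus_1[OF z])
  also have "\<dots> \<le> jost_bound * \<bar>q\<bar> ^ k"
    using mono jost_bound_nonneg by (intro mult_left_mono)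
  finally have e0: "cmod (jost z (Suc k) - 1) \<le> jost_bound * \<bar>q\<bar> ^ k" .
  also have "\<dots> \<le> err_const * \<bar>q\<bar> ^ k"
    using jost_bound_nonneg by (intro mult_right_mono) (auto simp: err_const_def)
  finally have e1: "cmod (jost z (Suc k) - 1) \<le> err_const * \<bar>q\<bar> ^ k" .
  have "cmod (jost z (Suc (Suc k)) - 1) \<le> jost_bound * \<bar>q\<bar> ^ Suc (Suc k)"
    unfolding jost_bound_def by (rule norm_jost_minus_1[OF z])
  also have "\<dots> \<le> jost_bound * \<bar>q\<bar> ^ k"
    using mono jost_bound_nonneg by (intro mult_left_mono)
  finally have f: "cmod (jost z (Suc (Suc k)) - 1) \<le> jost_bound * \<bar>q\<bar> ^ k" .
  have "of_real (t (Suc k)) * jost z (Suc (Suc k)) - 1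
      = (jost z (Suc (Suc k)) - 1) + of_real (r * q ^ Suc k) * jost z (Suc (Suc k))"
    by (simp add: t_def algebra_simps)
  then have "cmod (of_real (t (Suc k)) * jost z (Suc (Suc k)) - 1)
      \<le> cmod (jost z (Suc (Suc k)) - 1) + cmod (of_real (r * q ^ Suc k) * jost z (Suc (Suc k)))"
    by (metis norm_triangle_ineq)
  also have "cmod (of_real (r * q ^ Suc k) * jost z (Suc (Suc k))) \<le> (\<bar>r\<bar> * \<bar>q\<bar> ^ k) * (1 + jost_bound)"
    unfolding norm_mult norm_of_real abs_mult power_abs
    using mono(1) norm_jost_le[OF z] jost_bound_nonneg by (intro mult_mono mult_left_mono) auto
  finally have e2: "cmod (of_real (t (Suc k)) * jost z (Suc (Suc k)) - 1) \<le> err_const * \<bar>q\<bar> ^ k"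
    using f by (simp add: err_const_def algebra_simps)
  have "?d = of_real a * (jost z (Suc k) - 1) - z * of_real b * (of_real (t (Suc k)) * jost z (Suc (Suc k)) - 1)"
    by (simp add: a_def b_def algebra_simps)
  then have "cmod ?d \<le> cmod (of_real a * (jost z (Suc k) - 1))
      + cmod (z * of_real b * (of_real (t (Suc k)) * jost z (Suc (Suc k)) - 1))"
    by (metis norm_triangle_ineq4)
  also have "\<dots> = \<bar>a\<bar> * cmod (jost z (Suc k) - 1) + \<bar>b\<bar> * cmod (of_real (t (Suc k)) * jost z (Suc (Suc k)) - 1)"
    by (simp add: norm_mult z)
  also have "\<dots> \<le> \<bar>a\<bar> * (err_const * \<bar>q\<bar> ^ k) + \<bar>b\<bar> * (err_const * \<bar>q\<bar> ^ k)"
    using e1 e2 by (intro add_mono mult_left_mono) auto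
  finally show ?thesis by (simp add: a_def b_def algebra_simps)
qed

lemma norm_diff_unit_ge:
  assumes z: "cmod z = 1" "Im z \<ge> 0"
  shows "Im z * (\<bar>a\<bar> + \<bar>b\<bar>) \<le> 2 * cmod (of_real a - z * of_real b)"
proof -
  have "Im z * \<bar>b\<bar> = \<bar>Im (of_real a - z * of_real b)\<bar>" using z by (simp add: abs_mult)
  also have "\<dots> \<le> cmod (of_real a - z * of_real b)" by (rule abs_Im_le_cmod)
  finally have 1: "Im z * \<bar>b\<bar> \<le> cmod (of_real a - z * of_real b)" .
  have "Im z * \<bar>a\<bar> = \<bar>Im (cnj z * (of_real a - z * of_real b))\<bar>"
    using z by (simp add: abs_mult algebra_simps)
  also have "\<dots> \<le> cmod (cnj z * (of_real a - z * of_real b))" by (rule abs_Im_le_cmod)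
  finally have 2: "Im z * \<bar>a\<bar> \<le> cmod (of_real a - z * of_real b)" using z by (simp add: norm_mult)
  from 1 2 show ?thesis by (simp add: algebra_simps)
qed

text \<open>The unperturbed Wronskian controls \<open>p\<close> with a constant proportional to \<open>Im z\<close>, and its distance from
  the constant Wronskian is eventually absorbed into that estimate.\<close>

lemma p_locally_bounded:
  assumes \<sigma>: "\<sigma> > 0"
  obtains K where "\<And>k z. k \<ge> K \<Longrightarrow> cmod z = 1 \<Longrightarrow> Im z \<ge> \<sigma> \<Longrightarrow>
      \<sigma> * (\<bar>p (Re z) (Suc k)\<bar> + \<bar>p (Re z) k\<bar>) \<le> 4 * cmod (jost z 0)"
proof -
  have "(\<lambda>k. err_const * \<bar>q\<bar> ^ k) \<longlonglongrightarrow> err_const * 0"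
    using q_less_1 by (intro tendsto_mult tendsto_const LIMSEQ_power_zero) auto
  then have "eventually (\<lambda>k. err_const * \<bar>q\<bar> ^ k < \<sigma> / 4) sequentially"
    using \<sigma> by (intro order_tendstoD(2)[where y = "err_const * 0"]) auto
  then obtain K where K: "\<And>k. k \<ge> K \<Longrightarrow> err_const * \<bar>q\<bar> ^ k < \<sigma> / 4"
    by (auto simp: eventually_sequentially)
  show ?thesis
  proof (rule that)
    fix k z assume k: "k \<ge> K" and z: "cmod z = 1" "Im z \<ge> \<sigma>"
    define S where "S = \<bar>p (Re z) (Suc k)\<bar> + \<bar>p (Re z) k\<bar>"
    define w where "w = of_real (p (Re z) (Suc k)) * jost z (Suc k)
           - of_real (t (Suc k)) * z * of_real (p (Re z) k) * jost z (Suc (Suc k))"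
    define u where "u = of_real (p (Re z) (Suc k)) - z * of_real (p (Re z) k)"
    have "S \<ge> 0" by (simp add: S_def)
    have "\<sigma> * S \<le> Im z * S" using z \<open>S \<ge> 0\<close> by (intro mult_right_mono)
    also have "\<dots> \<le> 2 * cmod u"
      unfolding S_def u_def using z \<sigma> by (intro norm_diff_unit_ge) auto
    also have "cmod u \<le> cmod w + cmod (w - u)"
      by (metis add_diff_cancel_left' diff_diff_eq2 norm_triangle_ineq4)
    also have "cmod (w - u) \<le> err_const * \<bar>q\<bar> ^ k * S"
      using free_wronskian_error[OF z(1), of k] by (simp only: w_def u_def S_def)
    also have "\<dots> \<le> \<sigma> / 4 * S" using K[OF k] \<open>S \<ge> 0\<close> by (intro mult_right_mono) auto
    also have "cmod w = cmod (jost z 0)" unfolding w_def by (rule wronskian_norm[OF z(1)])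
    finally have "\<sigma> * S \<le> 2 * (cmod (jost z 0) + \<sigma> / 4 * S)" by simp
    then show "\<sigma> * S \<le> 4 * cmod (jost z 0)" by (simp add: mult.commute)
  qed
qed

text \<open>If the series vanished, the previous bound would make two consecutive values of \<open>p\<close> vanish, and
  running the recurrence backwards would give \<open>p x 0 = 0\<close>.\<close>

lemma jost_nonzero:
  assumes z: "cmod z = 1" "Im z > 0"
  shows "jost z 0 \<noteq> 0"
proof
  assume "jost z 0 = 0"
  obtain K where K: "\<And>k w. k \<ge> K \<Longrightarrow> cmod w = 1 \<Longrightarrow> Im w \<ge> Im z \<Longrightarrow>
      Im z * (\<bar>p (Re w) (Suc k)\<bar> + \<bar>p (Re w) k\<bar>) \<le> 4 * cmod (jost w 0)"
    using p_locally_bounded[OF z(2)] by blast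
  have "Im z * (\<bar>p (Re z) (Suc K)\<bar> + \<bar>p (Re z) K\<bar>) \<le> 0"
    using K[of K z] z \<open>jost z 0 = 0\<close> by simp
  with z have "\<bar>p (Re z) (Suc K)\<bar> + \<bar>p (Re z) K\<bar> \<le> 0" by (simp add: mult_le_0_iff)
  then have "p (Re z) (Suc K) = 0 \<and> p (Re z) K = 0" by linarith
  then show False
  proof (induction K)
    case (Suc K)
    with t_pos[of K] show ?case by auto
  qed auto
qed

definition turan :: "real \<Rightarrow> nat \<Rightarrow> real" where
  "turan x k = (p x (Suc k))\<^sup>2 - p x (Suc (Suc k)) * p x k"

text \<open>For the unperturbed recurrence the Turan determinant is the squared modulus of the Wronskian.\<close>

lemma turan_tendsto:
  assumes z: "cmod z = 1" "Im z > 0"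
  shows "(\<lambda>k. turan (Re z) k) \<longlonglongrightarrow> (cmod (jost z 0))\<^sup>2"
proof -
  let ?p = "p (Re z)"
  define M where "M = 4 * cmod (jost z 0) / Im z"
  define w where "w k = of_real (?p (Suc k)) * jost z (Suc k)
           - of_real (t (Suc k)) * z * of_real (?p k) * jost z (Suc (Suc k))" for k
  define u where "u k = of_real (?p (Suc k)) - z * of_real (?p k)" for k
  obtain K where K: "\<And>k w. k \<ge> K \<Longrightarrow> cmod w = 1 \<Longrightarrow> Im w \<ge> Im z \<Longrightarrow>
      Im z * (\<bar>p (Re w) (Suc k)\<bar> + \<bar>p (Re w) k\<bar>) \<le> 4 * cmod (jost w 0)"
    using p_locally_bounded[OF z(2)] by blast
  have M: "\<bar>?p (Suc k)\<bar> + \<bar>?p k\<bar> \<le> M" if "k \<ge> K" for k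
    using K[OF that z(1)] z(2) by (simp add: M_def pos_le_divide_eq mult.commute)
  have M0: "M \<ge> 0" using z by (simp add: M_def)
  have q0: "(\<lambda>k. C * \<bar>q\<bar> ^ k) \<longlonglongrightarrow> 0" for C
    using tendsto_mult[OF tendsto_const[of C] LIMSEQ_power_zero[of "\<bar>q\<bar>"]] q_less_1 by simp
  have "(\<lambda>k. w k - u k) \<longlonglongrightarrow> 0"
  proof (rule Lim_null_comparison[OF _ q0[of "\<bar>err_const\<bar> * M"]])
    show "eventually (\<lambda>k. norm (w k - u k) \<le> \<bar>err_const\<bar> * M * \<bar>q\<bar> ^ k) sequentially"
      using eventually_ge_at_top[of K]
    proof eventually_elim
      case (elim k)
      have "norm (w k - u k) \<le> err_const * \<bar>q\<bar> ^ k * (\<bar>?p (Suc k)\<bar> + \<bar>?p k\<bar>)"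
        using free_wronskian_error[OF z(1), of k] by (simp only: w_def u_def)
      also have "\<dots> \<le> (\<bar>err_const\<bar> * \<bar>q\<bar> ^ k) * M"
        using M[OF elim] by (intro mult_mono mult_right_mono) auto
      finally show ?case by (simp add: mult_ac)
    qed
  qed
  moreover have "(\<lambda>k. cmod (u k) - cmod (jost z 0)) \<longlonglongrightarrow> 0"
  proof (rule Lim_null_comparison[OF _ tendsto_norm_zero[OF calculation]])
    have "\<bar>cmod (u k) - cmod (jost z 0)\<bar> \<le> cmod (w k - u k)" for k
      using wronskian_norm[OF z(1), of k] norm_triangle_ineq3[of "u k" "w k"]
      by (simp add: w_def norm_minus_commute)
    then show "eventually (\<lambda>k. norm (cmod (u k) - cmod (jost z 0)) \<le> norm (w k - u k)) sequentially"
      by simp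
  qed
  ultimately have "(\<lambda>k. cmod (u k)) \<longlonglongrightarrow> cmod (jost z 0)" by (simp add: LIM_zero_cancel)
  then have lim: "(\<lambda>k. (cmod (u k))\<^sup>2) \<longlonglongrightarrow> (cmod (jost z 0))\<^sup>2" by (rule tendsto_power)
  \<comment> \<open>The determinant equals \<open>|u k|\<^sup>2\<close> up to terms carrying a factor \<open>q ^ Suc k\<close>.\<close>
  define d where "d k = q ^ Suc k * (2 * c * ?p (Suc k) * ?p k + r * (?p k)\<^sup>2)" for k
  have eq: "turan (Re z) k = (cmod (u k))\<^sup>2 + d k" for k
  proof -
    have zz: "(Re z)\<^sup>2 + (Im z)\<^sup>2 = 1" using z(1) by (simp add: cmod_def)
    have "(cmod (u k))\<^sup>2 = (?p (Suc k) - Re z * ?p k)\<^sup>2 + (Im z * ?p k)\<^sup>2"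
      by (simp add: u_def cmod_power2)
    also have "\<dots> = (?p (Suc k))\<^sup>2 - 2 * Re z * ?p (Suc k) * ?p k + ((Re z)\<^sup>2 + (Im z)\<^sup>2) * (?p k)\<^sup>2"
      by (simp add: power2_eq_square algebra_simps)
    finally show ?thesis
      unfolding zz by (simp add: turan_def d_def t_def power2_eq_square algebra_simps)
  qed
  have "d \<longlonglongrightarrow> 0"
  proof (rule Lim_null_comparison[OF _ q0[of "2 * \<bar>c\<bar> * M * M + \<bar>r\<bar> * (M * M)"]])
    show "eventually (\<lambda>k. norm (d k) \<le> (2 * \<bar>c\<bar> * M * M + \<bar>r\<bar> * (M * M)) * \<bar>q\<bar> ^ k) sequentially"
      using eventually_ge_at_top[of K]
    proof eventually_elim
      case (elim k)
      have b: "\<bar>?p (Suc k)\<bar> \<le> M" "\<bar>?p k\<bar> \<le> M" using M[OF elim] by auto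
      have "\<bar>2 * c * ?p (Suc k) * ?p k + r * (?p k)\<^sup>2\<bar> \<le> \<bar>2 * c * ?p (Suc k) * ?p k\<bar> + \<bar>r * (?p k)\<^sup>2\<bar>"
        by (rule abs_triangle_ineq)
      also have "\<dots> \<le> 2 * \<bar>c\<bar> * M * M + \<bar>r\<bar> * (M * M)"
        unfolding abs_mult power2_eq_square using b M0
        by (intro add_mono mult_mono mult_left_mono) auto
      finally have "\<bar>q\<bar> ^ Suc k * \<bar>2 * c * ?p (Suc k) * ?p k + r * (?p k)\<^sup>2\<bar>
          \<le> \<bar>q\<bar> ^ k * (2 * \<bar>c\<bar> * M * M + \<bar>r\<bar> * (M * M))"
        using q_less_1 by (intro mult_mono power_decreasing) auto
      then show ?case by (simp only: d_def real_norm_def abs_mult power_abs mult.commute)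
    qed
  qed
  from tendsto_add[OF lim this] show ?thesis unfolding eq by simp
qed

lemma turan_locally_bounded:
  assumes \<sigma>: "\<sigma> > 0"
  obtains K C where "\<And>k z. k \<ge> K \<Longrightarrow> cmod z = 1 \<Longrightarrow> Im z \<ge> \<sigma> \<Longrightarrow> \<bar>turan (Re z) k\<bar> \<le> C"
proof -
  obtain K where K: "\<And>k z. k \<ge> K \<Longrightarrow> cmod z = 1 \<Longrightarrow> Im z \<ge> \<sigma> \<Longrightarrow>
      \<sigma> * (\<bar>p (Re z) (Suc k)\<bar> + \<bar>p (Re z) k\<bar>) \<le> 4 * cmod (jost z 0)"
    using p_locally_bounded[OF \<sigma>] by blast
  define M where "M = 4 * (1 + jost_bound) / \<sigma>"
  show ?thesis
  proof (rule that)
    fix k z assume k: "k \<ge> K" and z: "cmod z = 1" "Im z \<ge> \<sigma>"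
    have bd: "\<bar>p (Re z) (Suc j)\<bar> + \<bar>p (Re z) j\<bar> \<le> M" if "j \<ge> K" for j
    proof -
      have "\<sigma> * (\<bar>p (Re z) (Suc j)\<bar> + \<bar>p (Re z) j\<bar>) \<le> 4 * (1 + jost_bound)"
        by (rule order_trans[OF K[OF that z]]) (use norm_jost_le[OF z(1), of 0] in simp)
      then show ?thesis using \<sigma> by (simp add: M_def pos_le_divide_eq mult.commute)
    qed
    have b: "\<bar>p (Re z) k\<bar> \<le> M" "\<bar>p (Re z) (Suc k)\<bar> \<le> M" "\<bar>p (Re z) (Suc (Suc k))\<bar> \<le> M"
      using bd[OF k] bd[of "Suc k"] k by auto
    have "\<bar>turan (Re z) k\<bar> \<le> \<bar>p (Re z) (Suc k)\<bar> * \<bar>p (Re z) (Suc k)\<bar> + \<bar>p (Re z) (Suc (Suc k))\<bar> * \<bar>p (Re z) k\<bar>"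
      unfolding turan_def power2_eq_square abs_mult[symmetric] by (rule abs_triangle_ineq4)
    also have "\<dots> \<le> M * M + M * M"
      using b abs_ge_zero[of "p (Re z) k"] by (intro add_mono mult_mono) linarith+
    finally show "\<bar>turan (Re z) k\<bar> \<le> M * M + M * M" .
  qed
qed

end

section \<open>The orthogonality measure of the q-polynomials\<close>

text \<open>Distributing the power of \<open>-2 c\<close> over the rising factorial clears the denominators \<open>c\<close>, so that the
  cases \<open>c = 0\<close> and \<open>c \<noteq> 0\<close> are the same series.\<close>

lemma (in q_recurrence) R_fun_eq_jost:
  assumes b: "b \<noteq> 0" and r: "r = l / b"
  shows "R_fun q b c l \<theta> = - 1 / (\<i> * of_real (sin \<theta>)) * jost (exp (\<i> * of_real \<theta>)) 0"
proof -
  let ?z = "exp (\<i> * of_real \<theta>) :: complex"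
  have num: "R_numerator q b c l \<theta> m = (\<Prod>j<m. - 2 * of_real c - of_real r * of_real q ^ Suc j * ?z)" for m
  proof (cases "c = 0")
    case True
    then show ?thesis by (simp add: R_numerator_def r)
  next
    case False
    have "R_numerator q b c l \<theta> m =
      (\<Prod>j<m. (1 - (- of_real l * of_real q * ?z / (2 * of_real b * of_real c)) * of_real q ^ j) * (- 2 * of_real c))"
    proof -
      have "(\<Prod>j<m. u j) * v ^ m = (\<Prod>j<m. u j * v)" for u :: "nat \<Rightarrow> complex" and v
        by (simp add: prod.distrib)
      then show ?thesis using False by (simp only: R_numerator_def q_rising_def if_False)
    qed
    also have "\<dots> = (\<Prod>j<m. - 2 * of_real c - of_real r * of_real q ^ Suc j * ?z)"
      using False b by (intro prod.cong refl) (simp add: r field_simps)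
    finally show ?thesis .
  qed
  have pow: "exp (\<i> * of_nat m * of_real \<theta>) = ?z ^ m" for m
    by (simp add: exp_of_nat_mult[symmetric] mult_ac)
  have sq: "exp (2 * \<i> * of_real \<theta>) = ?z\<^sup>2"
    by (simp add: exp_double[symmetric] mult_ac)
  show ?thesis
    unfolding R_fun_def jost_def jost_coeff_def num pow sq by (simp add: mult_ac)
qed

lemma q_rising_tendsto_inf:
  fixes a q :: real
  assumes q: "\<bar>q\<bar> < 1" and a: "\<And>k. a * q ^ k \<noteq> 1"
  shows "(\<lambda>n. q_rising a q n) \<longlonglongrightarrow> q_rising_inf a q"
proof -
  have "summable (\<lambda>k. \<bar>a\<bar> * \<bar>q\<bar> ^ k)" using q by (intro summable_mult summable_geometric) auto
  then have "convergent_prod (\<lambda>k. 1 + (- (a * q ^ k)))"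
    using a by (intro summable_imp_convergent_prod_real) (auto simp: abs_mult power_abs)
  then have "(\<lambda>n. \<Prod>k\<le>n. 1 - a * q ^ k) \<longlonglongrightarrow> q_rising_inf a q"
    unfolding q_rising_inf_def using convergent_prod_LIMSEQ by simp
  then have "(\<lambda>n. q_rising a q (Suc n)) \<longlonglongrightarrow> q_rising_inf a q"
    by (simp add: q_rising_def lessThan_Suc_atMost)
  then show ?thesis by (rule LIMSEQ_imp_Suc)
qed

theorem theorem3p3:
  fixes q b c l :: real and P :: "nat \<Rightarrow> real poly"
  assumes "0 < \<bar>q\<bar>" and "\<bar>q\<bar> < 1"
    and "b < 0"
    and "\<And>k::nat. k \<ge> 1 \<Longrightarrow> 1 + l * q ^ k / b > 0"
    and "P 0 = 1"
    and "P 1 = [:- c, 1:]"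
    and "\<And>k::nat. k > 0 \<Longrightarrow>
           [:0, 1:] * P k =
             P (k + 1) + smult (c * q ^ k) (P k) + smult (1 / 4 * (1 + l * q ^ k / b)) (P (k - 1))"
  shows "\<exists>\<mu>::real measure.
           sets \<mu> = sets borel \<and>
           (\<forall>m n. integrable \<mu> (\<lambda>x. poly (P n) x * poly (P m) x) \<and>
                  (LINT x|\<mu>. poly (P n) x * poly (P m) x) =
                    1 / 4 ^ n * q_rising (- l * q / b) q n * (if m = n then 1 else 0)) \<and>
           (\<exists>f. ac_component_density \<mu> f \<and>
                (\<forall>\<theta>\<in>{0<..<pi}.
                   f (cos \<theta>) =
                     ennreal (2 / pi * q_rising_inf (- l * q / b) q
                       / ((cmod (R_fun q b c l \<theta>))\<^sup>2 * sqrt (1 - (cos \<theta>)\<^sup>2))))) \<and>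
           point_masses \<mu> \<inter> {-1<..<1} = {}"
proof -
  define r where "r = l / b"
  define \<beta> where "\<beta> k = c * q ^ k" for k :: nat
  define \<gamma> where "\<gamma> k = 1 / 4 * (1 + l * q ^ k / b)" for k :: nat
  have \<gamma>_pos: "\<gamma> (Suc k) > 0" for k using assms(4)[of "Suc k"] by (simp add: \<gamma>_def)
  interpret Q: q_recurrence q c r
    using assms(2) assms(4)[of "Suc _"] by unfold_locales (auto simp: r_def)
  interpret P: monic_recurrence P \<beta> \<gamma>
  proof
    fix k
    have "P (Suc (Suc k)) = [:0, 1:] * P (Suc k) - smult (\<beta> (Suc k)) (P (Suc k)) - smult (\<gamma> (Suc k)) (P k)"
      using assms(7)[of "Suc k"] by (simp add: \<beta>_def \<gamma>_def)
    also have "\<dots> = [:- \<beta> (Suc k), 1:] * P (Suc k) - smult (\<gamma> (Suc k)) (P k)"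
      by (simp add: algebra_simps)
    finally show "P (Suc (Suc k)) = [:- \<beta> (Suc k), 1:] * P (Suc k) - smult (\<gamma> (Suc k)) (P k)" .
  qed (use assms(5,6) \<gamma>_pos in \<open>auto simp: \<beta>_def\<close>)
  have \<gamma>_t: "\<gamma> k = Q.t k / 4" for k unfolding \<gamma>_def Q.t_def by (simp add: r_def)
  have qk: "\<bar>q\<bar> ^ k \<le> 1" for k using assms(2) by (simp add: power_le_one)
  have \<beta>_le: "\<bar>\<beta> k\<bar> \<le> \<bar>c\<bar>" for k
    using mult_left_mono[OF qk[of k], of "\<bar>c\<bar>"] by (simp add: \<beta>_def abs_mult power_abs)
  have \<gamma>_le: "\<gamma> (Suc k) \<le> 1 + \<bar>r\<bar>" for k
  proof -
    have "r * q ^ Suc k \<le> \<bar>r\<bar> * \<bar>q\<bar> ^ Suc k" by (metis abs_ge_self abs_mult power_abs)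
    also have "\<dots> \<le> \<bar>r\<bar> * 1" by (intro mult_left_mono qk) simp
    finally show ?thesis by (simp add: \<gamma>_t Q.t_def)
  qed
  obtain M B where M: "real_distribution M" and supp: "AE x in M. \<bar>x\<bar> \<le> B"
    and all_orth: "\<forall>k j. (LINT x|M. poly (P k) x * poly (P j) x) = (if k = j then P.sqnorm k else 0)"
    using P.favard_bounded[OF \<beta>_le \<gamma>_le] by blast
  have orth: "(LINT x|M. poly (P k) x * poly (P j) x) = (if k = j then P.sqnorm k else 0)" for k j
    using all_orth by blast
  interpret M: bounded_distribution M B
    by (intro bounded_distribution.intro bounded_distribution_axioms.intro M supp)
  have p_P: "Q.p x n = 2 ^ n * poly (P n) x" for x n
  proof (induction n rule: less_induct)
    case (less n)
    consider "n = 0" | "n = Suc 0" | k where "n = Suc (Suc k)" by (metis not0_implies_Suc)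
    then show ?case
    proof cases
      case 3
      then show ?thesis using less[of k] less[of "Suc k"]
        by (simp add: P.poly_P_recurrence(2) \<gamma>_t \<beta>_def algebra_simps)
    qed (simp_all add: P.P_0 P.P_1 \<beta>_def)
  qed
  define T where "T = q_rising_inf (- l * q / b) q"
  have h: "P.sqnorm n = 1 / 4 ^ n * q_rising (- l * q / b) q n" for n
  proof -
    have "P.sqnorm n = (\<Prod>i<n. 1 / 4 * (1 - (- l * q / b) * q ^ i))"
      unfolding P.sqnorm_def by (intro prod.cong refl) (simp add: \<gamma>_def)
    also have "\<dots> = 1 / 4 ^ n * q_rising (- l * q / b) q n"
      by (simp add: prod.distrib q_rising_def power_one_over prod_dividef)
    finally show ?thesis .
  qed
  have factor_pos: "1 - (- l * q / b) * q ^ k > 0" for k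
    using assms(4)[of "Suc k"] by simp
  have T_lim: "(\<lambda>n. q_rising (- l * q / b) q n) \<longlonglongrightarrow> T"
    unfolding T_def using factor_pos by (intro q_rising_tendsto_inf assms(2)) (metis less_irrefl diff_self)
  have T_nonneg: "T \<ge> 0"
  proof (rule LIMSEQ_le_const[OF T_lim], intro exI allI impI)
    show "0 \<le> q_rising (- l * q / b) q n" for n
      unfolding q_rising_def by (intro prod_nonneg ballI less_imp_le factor_pos)
  qed
  have q_lim: "(\<lambda>k. C * q ^ k) \<longlonglongrightarrow> 0" for C
    using tendsto_mult[OF tendsto_const[of C] LIMSEQ_power_zero[of q]] assms(2) by simp
  interpret F: asymptotically_free M B "\<lambda>n x. Q.p x n" "\<lambda>k. 2 * c * q ^ k" Q.t "q_rising (- l * q / b) q" T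
  proof
    show "continuous_on UNIV (\<lambda>x. Q.p x k)" for k unfolding p_P by (intro continuous_intros)
    show "2 * x * Q.p x (Suc k) = Q.p x (Suc (Suc k)) + 2 * c * q ^ Suc k * Q.p x (Suc k) + Q.t (Suc k) * Q.p x k" for x k
      by (simp add: algebra_simps)
    show "(LINT x|M. Q.p x j * Q.p x k) = (if j = k then q_rising (- l * q / b) q j else 0)" for j k
    proof -
      have "(LINT x|M. Q.p x j * Q.p x k) = (LINT x|M. (2 ^ j * 2 ^ k) * (poly (P j) x * poly (P k) x))"
        unfolding p_P by (simp add: mult_ac)
      also have "\<dots> = (2 ^ j * 2 ^ k) * (if j = k then P.sqnorm j else 0)" by (simp only: integral_mult_right_zero orth)
      also have "\<dots> = (if j = k then q_rising (- l * q / b) q j else 0)"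
        by (simp add: h power_mult_distrib[symmetric])
      finally show ?thesis .
    qed
    show "Q.t \<longlonglongrightarrow> 1"
      using tendsto_add[OF tendsto_const[of 1] q_lim[of r]] unfolding Q.t_def by simp
  qed (use T_lim q_lim[of "2 * c"] in auto)
  have turan: "F.turan_det n x = Q.turan x n" for n x by (simp add: F.turan_det_def Q.turan_def)
  \<comment> \<open>The point \<open>exp (\<i> \<theta>)\<close> with \<open>x = cos \<theta>\<close>.\<close>
  define z where "z x = Complex x (sqrt (1 - x\<^sup>2))" for x
  have z: "cmod (z x) = 1" "Re (z x) = x" "Im (z x) = sqrt (1 - x\<^sup>2)" if "\<bar>x\<bar> \<le> 1" for x
    using that by (simp_all add: z_def cmod_def abs_square_le_1)
  have zI: "\<bar>x\<bar> \<le> 1" "Im (z x) > 0" if "x \<in> {-1<..<1}" for x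
    using that z(3)[of x] by (auto simp: abs_square_less_1 abs_less_iff)
  \<comment> \<open>Limit of the Turan determinants on the open interval, and density of the limit measure.\<close>
  define \<Delta> where "\<Delta> x = (cmod (Q.jost (z x) 0))\<^sup>2" for x
  define w where "w x = 2 * T / pi * sqrt (1 - x\<^sup>2)" for x
  have D: "continuous_on UNIV (F.turan_det n)" for n by (rule F.continuous_turan_det)
  have lim: "(\<lambda>n. F.turan_det n x) \<longlonglongrightarrow> \<Delta> x" if "x \<in> {-1<..<1}" for x
    using Q.turan_tendsto[OF z(1) zI(2), OF zI(1)] that z(2)[OF zI(1)] by (simp add: turan \<Delta>_def)
  have bdd: "\<exists>K C. \<forall>n\<ge>K. \<forall>x. \<bar>x\<bar> \<le> 1 - d \<longrightarrow> \<bar>F.turan_det n x\<bar> \<le> C" if d: "d > 0" for d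
  proof (cases "d \<le> 1")
    case True
    define \<sigma> where "\<sigma> = sqrt (1 - (1 - d)\<^sup>2)"
    have "(1 - d)\<^sup>2 < 1" using d True by (simp add: abs_square_less_1)
    then have "\<sigma> > 0" by (simp add: \<sigma>_def)
    then obtain K C where KC: "\<And>k z. k \<ge> K \<Longrightarrow> cmod z = 1 \<Longrightarrow> Im z \<ge> \<sigma> \<Longrightarrow> \<bar>Q.turan (Re z) k\<bar> \<le> C"
      using Q.turan_locally_bounded by metis
    have "\<bar>F.turan_det n x\<bar> \<le> C" if n: "n \<ge> K" and x: "\<bar>x\<bar> \<le> 1 - d" for n x
    proof -
      have x1: "\<bar>x\<bar> \<le> 1" using x d by linarith
      have "x\<^sup>2 \<le> (1 - d)\<^sup>2" using power_mono[OF x abs_ge_zero, of 2] by simp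
      then have "\<sigma> \<le> Im (z x)" unfolding z(3)[OF x1] \<sigma>_def by simp
      from KC[OF n z(1)[OF x1] this] show ?thesis by (simp add: turan z(2)[OF x1])
    qed
    then show ?thesis by blast
  next
    case False
    then have "\<not> \<bar>x\<bar> \<le> 1 - d" for x :: real using abs_ge_zero[of x] by linarith
    then show ?thesis by blast
  qed
  have pos: "\<Delta> x > 0" if "x \<in> {-1<..<1}" for x
    using Q.jost_nonzero[OF z(1)[OF zI(1)[OF that]] zI(2)[OF that]] by (simp add: \<Delta>_def)
  have wc: "continuous_on {-1..1} w" unfolding w_def by (intro continuous_intros) auto
  have w0: "w x \<ge> 0" if "x \<in> {-1..1}" for x
    using that T_nonneg by (auto simp: w_def abs_square_le_1 abs_le_iff)
  have weak: "(\<lambda>n. LINT x|M. g x * F.turan_det n x) \<longlonglongrightarrow> integral {-1..1} (\<lambda>x. g x * w x)"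
    if "continuous_on UNIV g" for g
  proof -
    have "integral {-1..1} (\<lambda>x. g x * w x) = integral {-1..1} (\<lambda>x. 2 * T / pi * (g x * sqrt (1 - x\<^sup>2)))"
      by (simp add: w_def mult_ac)
    also have "\<dots> = 2 * T / pi * integral {-1..1} (\<lambda>x. g x * sqrt (1 - x\<^sup>2))"
      by (rule integral_mult_right)
    finally show ?thesis using F.turan_det_limit[OF that] by simp
  qed
  have sM: "sets M = sets borel" by simp
  note density = density_from_weak_limit[OF M.finite_measure_axioms sM D lim bdd pos wc w0 weak]
  define f0 where "f0 x = indicator {-1<..<1} x * ennreal (w x / \<Delta> x)" for x
  have f0m: "f0 \<in> borel_measurable borel" unfolding f0_def by (rule density(1))
  have ac: "emeasure M A = emeasure (density lborel f0) A" if "A \<in> sets borel" "A \<subseteq> {-1<..<1}" for A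
    unfolding f0_def by (rule density(2)) (assumption | rule that)+
  have "{-1<..<1::real} \<in> sets borel" by simp
  from ac_component_density_extend[OF M.finite_measure_axioms sM this f0m ac]
  obtain f where f: "ac_component_density M f" "\<forall>x\<in>{-1<..<1}. f x = f0 x" by blast
  show ?thesis
  proof (intro exI[of _ M] conjI allI exI[of _ f] ballI f(1) sM)
    show "integrable M (\<lambda>x. poly (P n) x * poly (P m) x)" for m n
      by (intro M.continuous_integrable continuous_intros)
    show "(LINT x|M. poly (P n) x * poly (P m) x)
        = 1 / 4 ^ n * q_rising (- l * q / b) q n * (if m = n then 1 else 0)" for m n
      by (simp add: orth h)
    fix \<theta> assume \<theta>: "\<theta> \<in> {0<..<pi}"
    have sin: "sin \<theta> > 0" using \<theta> by (intro sin_gt_zero) auto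
    have sq: "sqrt (1 - (cos \<theta>)\<^sup>2) = sin \<theta>" using sin by (simp add: sin_squared_eq[symmetric])
    have "(cos \<theta>)\<^sup>2 < 1"
      using sin_cos_squared_add[of \<theta>] zero_less_power[OF sin, of 2] by linarith
    then have "\<bar>cos \<theta>\<bar> < 1" by (simp add: abs_square_less_1)
    then have cosI: "cos \<theta> \<in> {-1<..<1}" by (simp add: abs_less_iff)
    have "z (cos \<theta>) = exp (\<i> * of_real \<theta>)"
      unfolding z_def sq by (simp add: complex_eq_iff cis_conv_exp[symmetric])
    then have "cmod (R_fun q b c l \<theta>) = cmod (Q.jost (z (cos \<theta>)) 0) / sin \<theta>"
      using Q.R_fun_eq_jost[of b l \<theta>] assms(3) sin by (simp add: r_def norm_mult norm_divide)
    then have R: "(cmod (R_fun q b c l \<theta>))\<^sup>2 = \<Delta> (cos \<theta>) / (sin \<theta>)\<^sup>2"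
      by (simp add: \<Delta>_def power_divide)
    have "f (cos \<theta>) = ennreal (w (cos \<theta>) / \<Delta> (cos \<theta>))"
      using bspec[OF f(2) cosI] cosI by (simp add: f0_def)
    also have "w (cos \<theta>) / \<Delta> (cos \<theta>) = 2 / pi * T / ((cmod (R_fun q b c l \<theta>))\<^sup>2 * sqrt (1 - (cos \<theta>)\<^sup>2))"
    proof -
      have "\<Delta> (cos \<theta>) / (sin \<theta>)\<^sup>2 * sin \<theta> = \<Delta> (cos \<theta>) / sin \<theta>"
        using sin by (simp add: power2_eq_square)
      then show ?thesis unfolding R w_def sq by simp
    qed
    finally show "f (cos \<theta>) = ennreal (2 / pi * q_rising_inf (- l * q / b) q
                       / ((cmod (R_fun q b c l \<theta>))\<^sup>2 * sqrt (1 - (cos \<theta>)\<^sup>2)))"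
      unfolding T_def .
  next
    have "emeasure M {x} = 0" if "x \<in> {-1<..<1}" for x
    proof -
      have "emeasure M {x} = emeasure (density lborel f0) {x}" using that by (intro ac) auto
      also have "\<dots> = 0"
        using absolutely_continuousD[OF absolutely_continuousI_density[of f0 lborel], of "{x}"] f0m by simp
      finally show ?thesis .
    qed
    then show "point_masses M \<inter> {-1<..<1} = {}" by (auto simp: point_masses_def)
  qed
qed

end
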